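(* Let $q$ be a prime number, let $m \ge 2$ be a divisor of $q-1$ and let $s \in \mathbb Z_q^*$ with $\mathrm{ord}_q(s) = m$, where $(m,q) \neq (2,3)$. Let $C_q \rtimes_s C_m$ be the group generated by $x$ and $y$ with relations $x^m = 1$, $y^q = 1$, $yx = xy^s$. Let $S$ be a sequence in $C_q \rtimes_s C_m$ with $m+q-2$ elements. Then the following are equivalent: (i) $S$ is free of product-$1$ subsequences; (ii) for some $1 \le t \le q-1$, some $1 \le i \le m-1$ with $\gcd(i,m) = 1$, and some $0 \le \nu_1, \dots, \nu_{m-1} \le q-1$, the sequence $S$ is (up to the order of its terms) $$S = ( \underbrace{y^t, y^t, \dots, y^t}_{q-1\text{ times}}, x^iy^{\nu_1}, x^iy^{\nu_2}, \dots, x^iy^{\nu_{m-1}} ).$$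
   Context: A sequence in a finite group $G$ (written multiplicatively) is a finite list of elements of $G$, repetition allowed. A subsequence $T=(g_{n_1},\dots,g_{n_k})$ (with $\{n_1,\dots,n_k\}$ a non-empty subset of the index set) is a product-$1$ subsequence if $g_{\sigma(n_1)}g_{\sigma(n_2)}\cdots g_{\sigma(n_k)} = 1$ for some permutation $\sigma$ of $\{n_1,\dots,n_k\}$. $S$ is free of product-$1$ subsequences if it has no non-empty product-$1$ subsequence. *)

theory Defs
  imports "HOL-Number_Theory.Number_Theory" "HOL-Algebra.Group" "HOL-Library.Multiset"
begin

text \<open>Concrete model of the metacyclic group C_q x|_s C_m generated by x, y with
  x^m = 1, y^q = 1, y x = x y^s.  The pair (a,b) with a < m, b < q stands for the
  element x^a y^b; since y^b x^c = x^c y^(b s^c), the product is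
  x^a y^b * x^c y^d = x^(a+c) y^(b s^c + d).\<close>

definition metacyclic :: "nat \<Rightarrow> nat \<Rightarrow> nat \<Rightarrow> (nat \<times> nat) monoid" where
  "metacyclic m q s =
     \<lparr> carrier = {0..<m} \<times> {0..<q},
       mult = (\<lambda>(a, b) (c, d). ((a + c) mod m, (b * s ^ c + d) mod q)),
       one = (0, 0) \<rparr>"

definition gen_x :: "nat \<times> nat" where "gen_x = (1, 0)"
definition gen_y :: "nat \<times> nat" where "gen_y = (0, 1)"

definition list_prod :: "('a, 'b) monoid_scheme \<Rightarrow> 'a list \<Rightarrow> 'a" where
  "list_prod G xs = foldr (\<lambda>a b. a \<otimes>\<^bsub>G\<^esub> b) xs \<one>\<^bsub>G\<^esub>"

definition has_product_one_subseq :: "('a, 'b) monoid_scheme \<Rightarrow> 'a list \<Rightarrow> bool" where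
  "has_product_one_subseq G S \<longleftrightarrow>
     (\<exists>js. js \<noteq> [] \<and> distinct js \<and> (\<forall>j\<in>set js. j < length S) \<and>
           list_prod G (map (\<lambda>j. S ! j) js) = \<one>\<^bsub>G\<^esub>)"

definition product_one_free :: "('a, 'b) monoid_scheme \<Rightarrow> 'a list \<Rightarrow> bool" where
  "product_one_free G S \<longleftrightarrow> \<not> has_product_one_subseq G S"

end

theory Submission
  imports Defs "HOL-Library.Set_Algebras" "HOL-Combinatorics.Permutations"
begin

text \<open>Let the rank of a multiset \<open>D\<close> over the group be the number of nontrivial elements of the normal
  subgroup \<open>\<langle>y\<rangle>\<close> that are products of terms of \<open>D\<close>. Cauchy--Davenport makes the rank superadditive on
  product-one free multisets. If the \<open>x\<close>-exponents of a product-one free \<open>E\<close> sum to \<open>0\<close> modulo \<open>m\<close>, then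
  the rank of \<open>E\<close> is at least its size: for minimal \<open>E\<close> the rotations of one product are conjugates
  by distinct powers of \<open>s\<close>. Since the rank is at most \<open>q - 1\<close>, removing from a free \<open>S\<close> of size
  \<open>m + q - 2\<close> a maximal zero-sum \<open>Z\<close> leaves exactly \<open>m - 1\<close> terms, zero-sum free modulo \<open>m\<close> and hence
  with one common \<open>x\<close>-exponent coprime to \<open>m\<close>. If \<open>Z\<close> contained a term outside \<open>\<langle>y\<rangle>\<close>, exchanging terms would
  produce \<open>2m - 1\<close> terms with the same \<open>x\<close>-exponent and rank at most \<open>m\<close>, but such a multiset has
  larger rank. So \<open>Z\<close> is a zero-sum free sequence of length \<open>q - 1\<close> in \<open>\<langle>y\<rangle>\<close>, which is constant.\<close>

subsection \<open>The Cauchy--Davenport theorem\<close>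

text \<open>Sets stay unreduced integers and only the counting is modulo \<open>p\<close>, so
  sumsets can be written as plain \<open>A + B\<close>.\<close>

definition card_mod :: "int \<Rightarrow> int set \<Rightarrow> nat" where
  "card_mod p A = card ((\<lambda>a. a mod p) ` A)"

lemma finite_residues: "p > 0 \<Longrightarrow> finite ((\<lambda>a. a mod p) ` A)" for p :: int
  by (rule finite_subset[of _ "{0..<p}"]) auto

lemma card_mod_le: "p > 0 \<Longrightarrow> card_mod p A \<le> nat p"
proof -
  assume "p > 0"
  then have "card ((\<lambda>a. a mod p) ` A) \<le> card {0..<p}"
    by (intro card_mono) auto
  then show ?thesis by (simp add: card_mod_def)
qed

lemma card_mod_mono:
  assumes "p > 0" "\<And>a. a \<in> A \<Longrightarrow> \<exists>b\<in>B. [a = b] (mod p)"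
  shows "card_mod p A \<le> card_mod p B"
  unfolding card_mod_def
proof (rule card_mono[OF finite_residues[OF assms(1)]])
  show "(\<lambda>a. a mod p) ` A \<subseteq> (\<lambda>a. a mod p) ` B"
    using assms(2) by (fastforce simp: cong_def)
qed

lemma inj_on_shift_mod: "inj_on (\<lambda>b. (b + e) mod p) {0..<p}" for p :: int
  by (rule inj_onI) (metis atLeastLessThan_iff cong_add_rcancel cong_def mod_pos_pos_trivial)

text \<open>As \<open>p\<close> is prime, \<open>d\<close> is invertible modulo \<open>p\<close>, so
  repeated shifts by \<open>d\<close> lead from one element of \<open>A\<close> to every
  residue.\<close>

lemma shift_closed_residues:
  fixes p d :: int
  assumes "prime p" "A \<subseteq> {0..<p}" "A \<noteq> {}" "\<not> p dvd d"
    and closed: "\<And>a. a \<in> A \<Longrightarrow> (a + d) mod p \<in> A"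
  shows "A = {0..<p}"
proof
  show "{0..<p} \<subseteq> A"
  proof
    fix x assume x: "x \<in> {0..<p}"
    have p0: "p > 0" using assms(1) prime_gt_0_int by blast
    obtain a where a: "a \<in> A" using assms(3) by blast
    have iter: "(a + int k * d) mod p \<in> A" for k
    proof (induction k)
      case 0
      then show ?case using a assms(2) by auto
    next
      case (Suc k)
      have "((a + int k * d) mod p + d) mod p = (a + int (Suc k) * d) mod p"
        by (simp add: algebra_simps mod_simps)
      then show ?case using closed[OF Suc] by simp
    qed
    have "coprime d p" using assms(1,4) by (metis coprime_commute prime_imp_coprime)
    then obtain c where c: "[d * c = 1] (mod p)" using cong_solve_coprime_int by blast
    define k where "k = nat ((c * (x - a)) mod p)"
    have "int k = (c * (x - a)) mod p" using p0 by (simp add: k_def)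
    then have "[int k = c * (x - a)] (mod p)" by (simp add: cong_def)
    then have "[a + int k * d = a + (c * (x - a)) * d] (mod p)"
      by (intro cong_add cong_mult cong_refl)
    also have "a + (c * (x - a)) * d = a + (d * c) * (x - a)" by (simp add: algebra_simps)
    also have "[a + (d * c) * (x - a) = a + 1 * (x - a)] (mod p)"
      by (intro cong_add cong_mult cong_refl c)
    finally have "(a + int k * d) mod p = x" using x by (simp add: cong_def)
    with iter[of k] show "x \<in> A" by simp
  qed
qed (fact assms(2))

text \<open>Davenport's transform: shifting \<open>B\<close> by a suitable \<open>e\<close> and replacing the pair \<open>(A, B + e)\<close> by
  union and intersection keeps the total size and shrinks \<open>B\<close>.\<close>

lemma cauchy_davenport_residues:
  fixes p :: int
  assumes "prime p" "A \<subseteq> {0..<p}" "A \<noteq> {}" "B \<subseteq> {0..<p}" "B \<noteq> {}"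
  shows "min (nat p) (card A + card B - 1) \<le> card {(a + b) mod p | a b. a \<in> A \<and> b \<in> B}"
  using assms(2-)
proof (induction "card B" arbitrary: A B rule: less_induct)
  case less
  have p0: "p > 0" using assms(1) prime_gt_0_int by blast
  have fin: "finite A" "finite B" using less.prems finite_subset by blast+
  define C where "C = {(a + b) mod p | a b. a \<in> A \<and> b \<in> B}"
  have finC: "finite C"
    by (rule finite_subset[of _ "{0..<p}"]) (use p0 in \<open>auto simp: C_def\<close>)
  obtain b2 where b2: "b2 \<in> B" using less.prems by blast
  have card_shift: "card ((\<lambda>b. (b + e) mod p) ` X) = card X" if "X \<subseteq> {0..<p}" for e X
    using inj_on_shift_mod that by (intro card_image) (rule inj_on_subset)
  show ?case
  \<comment> \<open>In both cases the single translate \<open>A + b2\<close> already attains the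
    bound.\<close>
  proof (cases "B = {b2} \<or> A = {0..<p}")
    case True
    have "(\<lambda>a. (a + b2) mod p) ` A \<subseteq> C" using b2 by (auto simp: C_def)
    then have "card A \<le> card C"
      using card_mono[OF finC] card_shift[of A b2] less.prems by metis
    moreover have "min (nat p) (card A + card B - 1) \<le> card A" using True by auto
    ultimately show ?thesis by (simp add: C_def)
  next
    case False
    then obtain b1 where b1: "b1 \<in> B" "b1 \<noteq> b2" using b2 by blast
    have "\<not> p dvd b1 - b2"
    proof
      assume "p dvd b1 - b2"
      then have "b1 mod p = b2 mod p" by (simp add: mod_eq_dvd_iff)
      then show False using b1 b2 less.prems by (auto simp: subset_iff)
    qed
    then obtain a where a: "a \<in> A" "(a + (b1 - b2)) mod p \<notin> A"
      using shift_closed_residues[OF assms(1)] less.prems False by metis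
    \<comment> \<open>The shift by \<open>e\<close> carries \<open>b2\<close> to \<open>a\<close>,
      which lies in \<open>A\<close>, but carries \<open>b1\<close> outside \<open>A\<close>. So
      \<open>B'\<close> below is nonempty and strictly smaller than \<open>B\<close>.\<close>
    define e where "e = a - b2"
    define sh where "sh = (\<lambda>b. (b + e) mod p)"
    define A' where "A' = A \<union> sh ` B"
    define B' where "B' = {b \<in> B. sh b \<in> A}"
    have "sh b2 = a" using a less.prems by (auto simp: sh_def e_def)
    then have b2': "b2 \<in> B'" using a b2 by (simp add: B'_def)
    have "sh b1 = (a + (b1 - b2)) mod p" by (simp add: sh_def e_def algebra_simps)
    then have "b1 \<notin> B'" using a by (simp add: B'_def)
    then have "B' \<subset> B" using b1 by (auto simp: B'_def)
    then have lt: "card B' < card B" using fin by (simp add: psubset_card_mono)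
    have A'sub: "A' \<subseteq> {0..<p}" using less.prems p0 by (auto simp: A'_def sh_def)
    have B'sub: "B' \<subseteq> {0..<p}" using less.prems by (auto simp: B'_def)
    have "A \<inter> sh ` B = sh ` B'" by (auto simp: B'_def)
    then have cards: "card A + card B = card A' + card B'"
      using card_Un_Int[of A "sh ` B"] fin card_shift[OF B'sub, of e] card_shift[of B e] less.prems
      by (simp add: A'_def sh_def)
    have "{(a + b) mod p | a b. a \<in> A' \<and> b \<in> B'} \<subseteq> C"
    proof clarify
      fix x y assume x: "x \<in> A'" and y: "y \<in> B'"
      show "(x + y) mod p \<in> C"
      proof (cases "x \<in> A")
        case True
        then show ?thesis using y by (auto simp: C_def B'_def)
      next
        case False
        then obtain b where b: "b \<in> B" "x = sh b" using x by (auto simp: A'_def)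
        \<comment> \<open>The shift is handed over from \<open>b\<close> to \<open>y\<close>:
          \<open>(b + e) + y = (y + e) + b\<close>, and \<open>y + e\<close> lies in
          \<open>A\<close> modulo \<open>p\<close>.\<close>
        have "(x + y) mod p = (sh y + b) mod p"
          by (simp add: b sh_def mod_simps algebra_simps)
        moreover have "sh y \<in> A" using y by (simp add: B'_def)
        ultimately show ?thesis using b(1) unfolding C_def by blast
      qed
    qed
    then have "card {(a + b) mod p | a b. a \<in> A' \<and> b \<in> B'} \<le> card C"
      by (rule card_mono[OF finC])
    moreover have "min (nat p) (card A' + card B' - 1) \<le> card {(a + b) mod p | a b. a \<in> A' \<and> b \<in> B'}"
      using less.hyps[OF lt A'sub _ B'sub] b2' a by (auto simp: A'_def)
    ultimately show ?thesis using cards by (simp add: C_def)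
  qed
qed

theorem cauchy_davenport:
  fixes p :: int
  assumes "prime p" "A \<noteq> {}" "B \<noteq> {}"
  shows "min (nat p) (card_mod p A + card_mod p B - 1) \<le> card_mod p (A + B)"
proof -
  let ?r = "\<lambda>X. (\<lambda>a. a mod p) ` X"
  have "p > 0" using assms(1) prime_gt_0_int by blast
  then have "min (nat p) (card (?r A) + card (?r B) - 1)
      \<le> card {(a + b) mod p | a b. a \<in> ?r A \<and> b \<in> ?r B}"
    using assms by (intro cauchy_davenport_residues) auto
  also have "{(a + b) mod p | a b. a \<in> ?r A \<and> b \<in> ?r B} = ?r (A + B)"
  proof -
    have "{(a + b) mod p | a b. a \<in> ?r A \<and> b \<in> ?r B} = (\<lambda>(a, b). (a mod p + b mod p) mod p) ` (A \<times> B)"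
      by auto
    also have "\<dots> = ?r (A + B)"
      by (auto simp: set_plus_def mod_add_eq image_iff)
    finally show ?thesis .
  qed
  finally show ?thesis by (simp add: card_mod_def)
qed

subsection \<open>Zero-sum free multisets of residues\<close>

text \<open>The weight \<open>f\<close> is a parameter because both coordinates occur:
  \<open>fst\<close> modulo \<open>m\<close> and \<open>snd\<close> modulo \<open>q\<close>.\<close>

definition zero_sum_free :: "nat \<Rightarrow> ('a \<Rightarrow> nat) \<Rightarrow> 'a multiset \<Rightarrow> bool" where
  "zero_sum_free n f M \<longleftrightarrow> (\<forall>N. N \<subseteq># M \<longrightarrow> N \<noteq> {#} \<longrightarrow> \<not> n dvd (\<Sum>x\<in>#N. f x))"

lemma sum_mset_mset_eq_sum_list: "(\<Sum>x\<in>#mset xs. f x) = sum_list (map f xs)"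
  for f :: "'a \<Rightarrow> nat"
  by (metis mset_map sum_mset_sum_list)

lemma mset_segment_subset: "mset (drop j (take k xs)) \<subseteq># mset xs"
  by (metis append_take_drop_id mset_append mset_subset_eq_add_left mset_subset_eq_add_right subset_mset.order_trans)

text \<open>Two partial sums differ by the sum of a segment. The bound \<open>l\<close> may be
  smaller than the length: in a minimal zero sum only proper segments are known to be
  nonzero.\<close>

lemma inj_on_partial_sums:
  fixes f :: "'a \<Rightarrow> nat"
  assumes "\<And>j k. j < k \<Longrightarrow> k \<le> l \<Longrightarrow> \<not> n dvd sum_list (map f (drop j (take k xs)))"
  shows "inj_on (\<lambda>k. sum_list (map f (take k xs)) mod n) {0..l}"
proof -
  have "sum_list (map f (take j xs)) mod n \<noteq> sum_list (map f (take k xs)) mod n"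
    if "j < k" "k \<le> l" for j k
  proof
    assume eq: "sum_list (map f (take j xs)) mod n = sum_list (map f (take k xs)) mod n"
    have "sum_list (map f (take k xs)) = sum_list (map f (take j xs)) + sum_list (map f (drop j (take k xs)))"
      by (metis append_take_drop_id map_append min.absorb_iff1 nat_less_le sum_list_append take_take that(1))
    then have "n dvd sum_list (map f (drop j (take k xs)))"
      using eq by (metis add_diff_cancel_left' le_add1 mod_eq_dvd_iff_nat)
    then show False using assms that by blast
  qed
  then show ?thesis by (intro inj_onI) (metis atLeastAtMost_iff nat_neq_iff)
qed

lemma zero_sum_free_segment:
  assumes "zero_sum_free n f (mset xs)" "j < k" "k \<le> length xs"
  shows "\<not> n dvd sum_list (map f (drop j (take k xs)))"
proof -
  have "mset (drop j (take k xs)) \<subseteq># mset xs"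
    by (rule mset_segment_subset)
  moreover have "mset (drop j (take k xs)) \<noteq> {#}" using assms by simp
  ultimately show ?thesis
    using assms(1) unfolding zero_sum_free_def by (metis sum_mset_mset_eq_sum_list)
qed

text \<open>In any enumeration the \<open>size M + 1\<close> partial sums, the empty one included,
  are distinct residues modulo \<open>n\<close>.\<close>

lemma zero_sum_free_size:
  assumes "zero_sum_free n f M" "n > 0"
  shows "size M < n"
proof -
  obtain xs where xs: "M = mset xs" using ex_mset by metis
  have "card {0..length xs} \<le> card {0..<n}"
  proof (rule card_inj_on_le)
    show "inj_on (\<lambda>k. sum_list (map f (take k xs)) mod n) {0..length xs}"
      by (rule inj_on_partial_sums) (use zero_sum_free_segment assms xs in blast)
  qed (use assms in auto)
  then show ?thesis by (simp add: xs)
qed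

text \<open>For a zero-sum free list \<open>a, b, \<dots>\<close> of maximal length the partial sums are all the nonzero residues.
  So \<open>b\<close> is one of them, and freeness leaves only the partial sum \<open>a\<close>.\<close>

lemma zero_sum_free_maximal_const:
  assumes "zero_sum_free n f M" "n > 0" "size M = n - 1" "a \<in># M" "b \<in># M"
  shows "[f a = f b] (mod n)"
proof (cases "a = b")
  case False
  then obtain M' where M': "M = {#a, b#} + M'"
    using assms(4,5) by (metis add_mset_add_single insert_noteq_member mset_add union_mset_add_mset_left add_0 union_commute)
  obtain ys where ys: "M' = mset ys" using ex_mset by metis
  define xs where "xs = a # b # ys"
  have M: "M = mset xs" by (simp add: xs_def M' ys)
  define ps where "ps = (\<lambda>k. sum_list (map f (take k xs)) mod n)"
  have inj: "inj_on ps {0..length xs}"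
    unfolding ps_def by (rule inj_on_partial_sums) (use zero_sum_free_segment assms M in blast)
  have len: "length xs = n - 1" using assms M by simp
  have "ps ` {0..length xs} = {0..<n}"
  proof (rule card_subset_eq)
    show "card (ps ` {0..length xs}) = card {0..<n}"
      using card_image[OF inj] len assms(2) by simp
  qed (use assms(2) in \<open>auto simp: ps_def\<close>)
  moreover have "f b mod n \<in> {0..<n}" using assms(2) by simp
  ultimately obtain k where k: "k \<le> length xs" "f b mod n = ps k"
    by (metis atLeastAtMost_iff imageE)
  consider "k = 0" | "k = 1" | l where "k = Suc (Suc l)" by (metis One_nat_def not0_implies_Suc)
  then show ?thesis
  proof cases
    case 1
    then have "n dvd f b" using k by (auto simp: ps_def)
    moreover have "{#b#} \<subseteq># M" using assms(5) by simp
    ultimately show ?thesis using assms(1) unfolding zero_sum_free_def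
      by (metis empty_not_add_mset image_mset_single sum_mset.singleton)
  next
    case 2
    then show ?thesis using k by (simp add: ps_def xs_def cong_def)
  next
    case 3
    \<comment> \<open>This partial sum contains \<open>f b\<close> itself; cancelling it leaves a
      zero sum of \<open>a\<close> and the first \<open>l\<close> entries of
      \<open>ys\<close>.\<close>
    have "[0 + f b = (f a + sum_list (map f (take l ys))) + f b] (mod n)"
      using k 3 by (simp add: ps_def xs_def cong_def algebra_simps)
    then have "n dvd f a + sum_list (map f (take l ys))"
      by (metis cong_add_rcancel_nat cong_0_iff cong_sym)
    moreover have "mset (a # take l ys) \<subseteq># M"
      unfolding M xs_def by (metis M append_take_drop_id mset.simps(2) mset_append mset_subset_eq_add_left
         add_mset_add_single mset_subset_eq_add_right subset_mset.order_trans subset_mset.add_mono subset_mset.order_refl union_mset_add_mset_left)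
    ultimately show ?thesis using assms(1) unfolding zero_sum_free_def
      by (metis list.simps(9) mset_zero_iff list.distinct(1) sum_list.Cons sum_mset_mset_eq_sum_list)
  qed
qed simp

subsection \<open>Products in the metacyclic group\<close>

abbreviation xexp :: "(nat \<times> nat) list \<Rightarrow> nat" where
  "xexp xs \<equiv> sum_list (map fst xs)"

abbreviation xsum :: "(nat \<times> nat) multiset \<Rightarrow> nat" where
  "xsum M \<equiv> (\<Sum>g\<in>#M. fst g)"

text \<open>The exponent of \<open>y\<close> once all powers of \<open>x\<close> are collected on
  the left: passing \<open>x^c\<close> multiplies an exponent of \<open>y\<close> by
  \<open>s^c\<close>. It is kept as an unreduced integer.\<close>

primrec yexp :: "nat \<Rightarrow> (nat \<times> nat) list \<Rightarrow> int" where
  "yexp s [] = 0"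
| "yexp s (g # xs) = int (snd g) * int s ^ xexp xs + yexp s xs"

lemma yexp_append: "yexp s (xs @ ys) = yexp s xs * int s ^ xexp ys + yexp s ys"
  by (induction xs) (auto simp: algebra_simps power_add)

lemma xsum_mset: "xsum (mset xs) = xexp xs"
  by (rule sum_mset_mset_eq_sum_list)

locale metacyclic_params =
  fixes q m s :: nat
  assumes prime_q: "prime q" and m_ge_2: "m \<ge> 2"
    and s_pos: "0 < s" and s_less: "s < q" and ord_s: "Pocklington.ord q s = m"
begin

lemma q_pos: "q > 0"
  using prime_q prime_gt_0_nat by blast

lemma prime_int_q: "prime (int q)"
  using prime_q by simp

lemma coprime_q_s: "coprime q s"
  using prime_q s_pos s_less by (metis dvd_imp_le not_le prime_imp_coprime)

lemma power_cong_iff: "[int s ^ a = int s ^ b] (mod int q) \<longleftrightarrow> [a = b] (mod m)"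
  using order_divides_expdiff[OF coprime_q_s, of a b] ord_s cong_int_iff[of "s ^ a" "s ^ b" q]
  by simp

lemma power_mod: "[int s ^ (a mod m) = int s ^ a] (mod int q)"
  by (simp add: power_cong_iff)

lemma m_less_q: "m < q"
proof -
  have "m dvd q - 1"
    using order_divides_totient[OF coprime_q_s] ord_s totient_prime[OF prime_q] by simp
  moreover have "q > 1" using prime_q prime_gt_1_nat by blast
  ultimately have "m \<le> q - 1" by (simp add: dvd_imp_le)
  then show ?thesis using \<open>q > 1\<close> by simp
qed

abbreviation "G \<equiv> metacyclic m q s"

lemma carrier_G: "carrier G = {0..<m} \<times> {0..<q}"
  by (simp add: metacyclic_def)

lemma one_G: "\<one>\<^bsub>G\<^esub> = (0, 0)"
  by (simp add: metacyclic_def)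

lemma mult_G: "(a, b) \<otimes>\<^bsub>G\<^esub> (c, d) = ((a + c) mod m, (b * s ^ c + d) mod q)"
  by (simp add: metacyclic_def)

text \<open>The group law reduces the exponent of \<open>x\<close> at every step; powers of
  \<open>s\<close> modulo \<open>q\<close> do not notice this, since \<open>s\<close> has order
  \<open>m\<close>.\<close>

lemma list_prod_eq:
  "list_prod G xs = (xexp xs mod m, nat (yexp s xs mod int q))"
proof (induction xs)
  case Nil
  then show ?case by (simp add: list_prod_def one_G)
next
  case (Cons g xs)
  obtain a b where g: "g = (a, b)" by (cases g)
  have nonneg: "0 \<le> yexp s xs mod int q" using q_pos by simp
  have "list_prod G (g # xs) = g \<otimes>\<^bsub>G\<^esub> list_prod G xs" by (simp add: list_prod_def)
  also have "\<dots> = ((a + xexp xs mod m) mod m,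
      (b * s ^ (xexp xs mod m) + nat (yexp s xs mod int q)) mod q)"
    by (simp add: Cons g mult_G)
  also have "(b * s ^ (xexp xs mod m) + nat (yexp s xs mod int q)) mod q
      = nat ((int b * int s ^ (xexp xs mod m) + yexp s xs mod int q) mod int q)"
    using nonneg by (simp add: nat_mod_distrib nat_add_distrib nat_mult_distrib nat_power_eq)
  also have "(int b * int s ^ (xexp xs mod m) + yexp s xs mod int q) mod int q
      = (int b * int s ^ xexp xs + yexp s xs) mod int q"
    unfolding cong_def[symmetric]
    by (intro cong_add cong_mult cong_refl power_mod) simp
  finally show ?case by (simp add: g mod_simps)
qed

lemma list_prod_eq_one_iff:
  "list_prod G xs = \<one>\<^bsub>G\<^esub> \<longleftrightarrow> m dvd xexp xs \<and> int q dvd yexp s xs"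
proof -
  have "yexp s xs mod int q \<ge> 0" using q_pos by simp
  then show ?thesis by (auto simp: list_prod_eq one_G)
qed

text \<open>Product-one freeness without positions: a list \<open>xs\<close> is a subsequence
  together with an order of multiplication, and the two divisibilities say that its product is
  trivial.\<close>

definition free :: "(nat \<times> nat) multiset \<Rightarrow> bool" where
  "free D \<longleftrightarrow> (\<forall>xs. xs \<noteq> [] \<longrightarrow> mset xs \<subseteq># D \<longrightarrow> m dvd xexp xs \<longrightarrow> \<not> int q dvd yexp s xs)"

lemma freeD: "free D \<Longrightarrow> xs \<noteq> [] \<Longrightarrow> mset xs \<subseteq># D \<Longrightarrow> m dvd xexp xs \<Longrightarrow> \<not> int q dvd yexp s xs"
  unfolding free_def by blast

lemma free_mono: "free D \<Longrightarrow> E \<subseteq># D \<Longrightarrow> free E"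
  unfolding free_def using subset_mset.order_trans by blast

text \<open>Distinct positions select a submultiset in a chosen order. Conversely, \<open>xs\<close>
  followed by its complement is a permutation of \<open>S\<close>, and the first
  \<open>length xs\<close> values of that permutation are the required positions.\<close>

lemma product_one_free_iff: "product_one_free G S \<longleftrightarrow> free (mset S)"
proof
  assume free: "free (mset S)"
  show "product_one_free G S"
    unfolding product_one_free_def has_product_one_subseq_def
  proof clarify
    fix js assume js: "js \<noteq> []" "distinct js" "\<forall>j\<in>set js. j < length S"
      and one: "list_prod G (map ((!) S) js) = \<one>\<^bsub>G\<^esub>"
    have "mset js \<subseteq># mset [0..<length S]"
    proof -
      have "mset js = mset_set (set js)" using js(2) by (simp add: mset_set_set)
      moreover have "set js \<subseteq> {0..<length S}" using js(3) by auto
      ultimately show ?thesis by (simp add: subset_imp_msubset_mset_set)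
    qed
    then have "mset (map ((!) S) js) \<subseteq># mset (map ((!) S) [0..<length S])"
      unfolding mset_map by (rule image_mset_subseteq_mono)
    then have "mset (map ((!) S) js) \<subseteq># mset S" by (simp add: map_nth del: mset_map)
    then show False using freeD[OF free] one js(1) list_prod_eq_one_iff
      by (metis map_is_Nil_conv)
  qed
next
  assume pof: "product_one_free G S"
  show "free (mset S)"
    unfolding free_def
  proof (intro allI impI notI)
    fix xs assume xs: "xs \<noteq> []" "mset xs \<subseteq># mset S" "m dvd xexp xs" "int q dvd yexp s xs"
    obtain ys where ys: "mset S - mset xs = mset ys" using ex_mset by metis
    have "mset (xs @ ys) = mset S" using xs(2) by (simp add: ys[symmetric])
    then obtain f where f: "f permutes {..<length S}" "permute_list f S = xs @ ys"
      using mset_eq_permutation by metis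
    have len: "length (xs @ ys) = length S" using f by (metis length_permute_list)
    define js where "js = map f [0..<length xs]"
    have "map ((!) S) js = xs"
    proof (rule nth_equalityI)
      fix k assume k: "k < length (map ((!) S) js)"
      then have k': "k < length xs" by (simp add: js_def)
      then have "map ((!) S) js ! k = permute_list f S ! k"
        using len by (simp add: js_def permute_list_nth[OF f(1)])
      then show "map ((!) S) js ! k = xs ! k" using k' by (simp add: f(2) nth_append)
    qed (simp add: js_def)
    moreover have "distinct js"
      unfolding js_def using permutes_inj[OF f(1)] by (auto simp: distinct_map intro: inj_on_subset)
    moreover have "\<forall>j\<in>set js. j < length S"
      using permutes_in_image[OF f(1)] len by (auto simp: js_def)
    moreover have "js \<noteq> []" using xs(1) by (simp add: js_def)
    ultimately have "has_product_one_subseq G S"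
      unfolding has_product_one_subseq_def using list_prod_eq_one_iff xs by metis
    then show False using pof by (simp add: product_one_free_def)
  qed
qed

subsection \<open>The rank of a product-one free multiset\<close>

definition vals :: "(nat \<times> nat) multiset \<Rightarrow> int set" where
  "vals D = {yexp s xs | xs. mset xs \<subseteq># D \<and> m dvd xexp xs}"

text \<open>Subtracting one discards the residue \<open>0\<close>, which the empty list always
  contributes; if \<open>free D\<close> holds, no nonempty list contributes it.\<close>

definition rank :: "(nat \<times> nat) multiset \<Rightarrow> nat" where
  "rank D = card_mod (int q) (vals D) - 1"

lemma zero_in_vals: "0 \<in> vals D"
  unfolding vals_def by (auto intro: exI[of _ "[]"])

lemma card_mod_vals: "card_mod (int q) (vals D) = Suc (rank D)"
proof -
  have "card_mod (int q) (vals D) \<noteq> 0"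
    using zero_in_vals finite_residues[of "int q"] q_pos by (auto simp: card_mod_def)
  then show ?thesis by (simp add: rank_def)
qed

lemma rank_less: "rank D < q"
  using card_mod_le[of "int q" "vals D"] card_mod_vals[of D] q_pos by simp

text \<open>The factor \<open>s ^ xexp ys\<close> is 1 modulo \<open>q\<close>, so the exponents of
  \<open>y\<close> simply add.\<close>

lemma yexp_append_cong:
  assumes "m dvd xexp ys"
  shows "[yexp s (xs @ ys) = yexp s xs + yexp s ys] (mod int q)"
proof -
  have "[int s ^ xexp ys = int s ^ 0] (mod int q)"
    using assms by (simp only: power_cong_iff cong_0_iff)
  then have "[yexp s xs * int s ^ xexp ys + yexp s ys = yexp s xs * 1 + yexp s ys] (mod int q)"
    by (intro cong_add cong_mult cong_refl) simp
  then show ?thesis by (simp add: yexp_append)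
qed

text \<open>Cauchy--Davenport bounds the values of concatenated lists from below, up to the cap
  \<open>q\<close>. The cap is harmless: a nonzero value of \<open>D\<close> that is minus a value
  of \<open>E\<close> would give a product-one list, so the values of \<open>D\<close> and the
  negated values of \<open>E\<close> share only \<open>0\<close>, and their numbers add up to at
  most \<open>q + 1\<close>.\<close>

lemma rank_superadditive:
  assumes free: "free (D + E)"
  shows "rank D + rank E \<le> rank (D + E)"
proof -
  have app: "mset (xs @ ys) \<subseteq># D + E \<and> m dvd xexp (xs @ ys)"
    if "mset xs \<subseteq># D" "m dvd xexp xs" "mset ys \<subseteq># E" "m dvd xexp ys" for xs ys
    using subset_mset.add_mono[OF that(1,3)] dvd_add[OF that(2,4)] by simp
  let ?q = "int q"
  let ?A = "(\<lambda>a. a mod ?q) ` vals D" and ?B = "(\<lambda>a. a mod ?q) ` vals E"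
  let ?C = "(\<lambda>a. (- a) mod ?q) ` ?B"
  have sub: "?A \<subseteq> {0..<?q}" "?B \<subseteq> {0..<?q}" "?C \<subseteq> {0..<?q}" using q_pos by auto
  have fin: "finite ?A" "finite ?C" using q_pos by (simp_all add: finite_residues)
  have "inj_on (\<lambda>a. (- a) mod ?q) ?B"
  proof (rule inj_onI)
    fix x y assume "x \<in> ?B" "y \<in> ?B" and eq: "(- x) mod ?q = (- y) mod ?q"
    then have "x mod ?q = x" "y mod ?q = y" by auto
    moreover have "[x = y] (mod ?q)"
      using eq cong_minus_minus_iff[of x y ?q] unfolding cong_def by blast
    ultimately show "x = y" by (simp add: cong_def)
  qed
  then have cardC: "card ?C = card ?B" by (rule card_image)
  have "?A \<inter> ?C \<subseteq> {0}"
  proof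
    fix x assume x: "x \<in> ?A \<inter> ?C"
    then obtain xs where xs: "mset xs \<subseteq># D" "m dvd xexp xs" "x = yexp s xs mod ?q"
      unfolding vals_def by blast
    obtain b where b: "b \<in> vals E" "x = (- (b mod ?q)) mod ?q"
      using x by blast
    obtain ys where ys: "mset ys \<subseteq># E" "m dvd xexp ys" "b = yexp s ys"
      using b(1) unfolding vals_def by blast
    have "[yexp s xs + yexp s ys = 0] (mod ?q)"
    proof -
      have "[yexp s xs = - yexp s ys] (mod ?q)"
        using xs(3) b(2) unfolding ys(3) cong_def by (simp only: mod_minus_eq)
      then have "[yexp s xs + yexp s ys = - yexp s ys + yexp s ys] (mod ?q)"
        by (intro cong_add cong_refl)
      then show ?thesis by simp
    qed
    then have "?q dvd yexp s (xs @ ys)"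
      using yexp_append_cong[OF ys(2), of xs] by (metis cong_0_iff cong_trans)
    moreover have "mset (xs @ ys) \<subseteq># D + E" "m dvd xexp (xs @ ys)"
      using app[OF xs(1,2) ys(1,2)] by blast+
    ultimately have "xs @ ys = []" using freeD[OF free, of "xs @ ys"] by blast
    then show "x \<in> {0}" using xs(3) by simp
  qed
  then have "card (?A \<inter> ?C) \<le> 1" using card_mono[of "{0::int}" "?A \<inter> ?C"] by simp
  moreover have "card (?A \<union> ?C) \<le> q"
    using card_mono[of "{0..<?q}" "?A \<union> ?C"] sub by simp
  ultimately have le: "card ?A + card ?B \<le> Suc q"
    using card_Un_Int[OF fin] cardC by simp
  have "card_mod ?q (vals D + vals E) \<le> card_mod ?q (vals (D + E))"
  proof (rule card_mod_mono)
    fix a assume "a \<in> vals D + vals E"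
    then obtain xs ys where *: "mset xs \<subseteq># D" "m dvd xexp xs" "mset ys \<subseteq># E" "m dvd xexp ys"
      "a = yexp s xs + yexp s ys"
      unfolding set_plus_def vals_def by blast
    then have "[a = yexp s (xs @ ys)] (mod ?q)" using yexp_append_cong cong_sym by blast
    moreover have "yexp s (xs @ ys) \<in> vals (D + E)" using app * unfolding vals_def by blast
    ultimately show "\<exists>b\<in>vals (D + E). [a = b] (mod ?q)" by blast
  qed (use q_pos in simp)
  moreover have "min q (card_mod ?q (vals D) + card_mod ?q (vals E) - 1) \<le> card_mod ?q (vals D + vals E)"
  proof -
    have "vals D \<noteq> {}" "vals E \<noteq> {}" using zero_in_vals by blast+
    from cauchy_davenport[OF prime_int_q this] show ?thesis by simp
  qed
  ultimately show ?thesis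
    using le card_mod_vals[of D] card_mod_vals[of E] card_mod_vals[of "D + E"]
    unfolding card_mod_def by linarith
qed

lemma rank_mono: "free D \<Longrightarrow> E \<subseteq># D \<Longrightarrow> rank E \<le> rank D"
  using rank_superadditive[of E "D - E"] by (simp add: subset_mset.add_diff_inverse)

text \<open>Rotating a product \<open>y\<^sup>p\<close> conjugates it, i.e. multiplies \<open>p\<close> by a power of \<open>s\<close>. By minimality
  these powers are different for different rotations.\<close>

lemma rank_minimal_zero_sum:
  assumes free: "free T" and zero: "m dvd xsum T" and "T \<noteq> {#}"
    and minimal: "\<And>U. U \<subset># T \<Longrightarrow> U \<noteq> {#} \<Longrightarrow> \<not> m dvd xsum U"
  shows "size T \<le> rank T"
proof -
  obtain xs where T: "T = mset xs" using ex_mset by metis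
  define l where "l = length xs"
  have l: "l > 0" using assms(3) by (simp add: l_def T)
  define rot where "rot = (\<lambda>k. yexp s (drop k xs @ take k xs))"
  define A where "A = (\<lambda>k. xexp (take k xs))"
  have sum_split: "xexp (take k xs) + xexp (drop k xs) = xexp xs" for k
    by (metis append_take_drop_id map_append sum_list_append)
  have zero': "m dvd xexp xs" using zero by (simp add: T sum_mset_mset_eq_sum_list)
  have rot_perm: "mset (drop k xs @ take k xs) = T" for k
    unfolding T by (metis append_take_drop_id mset_append union_commute)
  have rot_zero: "m dvd xexp (drop k xs @ take k xs)" for k
    using zero' sum_split[of k] by (simp add: add.commute)
  have rot_nz: "\<not> int q dvd rot k" for k
    unfolding rot_def using freeD[OF free _ _ rot_zero] rot_perm[of k] assms(3)
    by (metis mset.simps(1) subset_mset.order_refl)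
  have rot_eq: "[rot k = int s ^ A k * yexp s xs] (mod int q)" for k
  proof -
    have "[int s ^ xexp xs = int s ^ 0] (mod int q)"
      using zero' by (simp only: power_cong_iff cong_0_iff)
    then have one: "[int s ^ A k * int s ^ xexp (drop k xs) = 1] (mod int q)"
      by (simp add: A_def sum_split flip: power_add)
    have "int s ^ A k * yexp s xs
        = yexp s (take k xs) * (int s ^ A k * int s ^ xexp (drop k xs)) + int s ^ A k * yexp s (drop k xs)"
      using yexp_append[of s "take k xs" "drop k xs"] by (simp add: algebra_simps)
    also have "[\<dots> = yexp s (take k xs) * 1 + int s ^ A k * yexp s (drop k xs)] (mod int q)"
      by (intro cong_add cong_mult cong_refl one)
    also have "yexp s (take k xs) * 1 + int s ^ A k * yexp s (drop k xs) = rot k"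
      by (simp add: rot_def yexp_append A_def algebra_simps)
    finally show ?thesis by (rule cong_sym)
  qed
  have cop: "coprime (yexp s xs) (int q)"
    using rot_nz[of 0] prime_int_q by (metis append_Nil2 coprime_commute drop0 prime_imp_coprime rot_def take0)
  \<comment> \<open>The range stops at \<open>l - 1\<close> because the full sum is again zero;
    segments between indices in this range are proper, so minimality applies to them.\<close>
  have "inj_on (\<lambda>k. A k mod m) {0..l - 1}"
    unfolding A_def
  proof (rule inj_on_partial_sums)
    fix j k assume jk: "j < k" "k \<le> l - 1"
    let ?seg = "drop j (take k xs)"
    have "mset ?seg \<subseteq># T"
      unfolding T by (rule mset_segment_subset)
    moreover have "size (mset ?seg) < size T" using jk l by (simp add: T l_def)
    ultimately have "mset ?seg \<subset># T" by (metis nat_neq_iff subset_mset.less_le)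
    moreover have "mset ?seg \<noteq> {#}" using jk l by (simp add: l_def)
    ultimately show "\<not> m dvd xexp ?seg" using minimal by (metis sum_mset_mset_eq_sum_list)
  qed
  then have inj: "inj_on (\<lambda>k. rot k mod int q) {0..<l}"
  proof -
    assume inj: "inj_on (\<lambda>k. A k mod m) {0..l - 1}"
    show ?thesis
    proof (rule inj_onI)
      fix j k assume jk: "j \<in> {0..<l}" "k \<in> {0..<l}" "rot j mod int q = rot k mod int q"
      then have "[int s ^ A j * yexp s xs = int s ^ A k * yexp s xs] (mod int q)"
        using rot_eq by (meson cong_def cong_sym cong_trans)
      then have "[int s ^ A j = int s ^ A k] (mod int q)"
        using cong_mult_rcancel[OF cop] by simp
      then have "A j mod m = A k mod m" using power_cong_iff unfolding cong_def by blast
      then show "j = k" using inj jk by (auto dest: inj_onD)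
    qed
  qed
  have "insert 0 ((\<lambda>k. rot k mod int q) ` {0..<l}) \<subseteq> (\<lambda>a. a mod int q) ` vals T"
  proof -
    have "rot k \<in> vals T" for k
      unfolding vals_def rot_def
      by (intro CollectI exI[of _ "drop k xs @ take k xs"] conjI refl)
        (simp_all only: rot_perm rot_zero subset_mset.order_refl)
    then show ?thesis using zero_in_vals[of T] by (force simp: image_iff)
  qed
  then have "card (insert 0 ((\<lambda>k. rot k mod int q) ` {0..<l})) \<le> Suc (rank T)"
    using card_mono finite_residues q_pos card_mod_vals[of T] by (metis card_mod_def of_nat_0_less_iff)
  moreover have "0 \<notin> (\<lambda>k. rot k mod int q) ` {0..<l}" using rot_nz by auto
  ultimately have "l \<le> rank T" using card_image[OF inj] by simp
  then show ?thesis by (simp add: T l_def)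
qed

end

section \<open>Zero-sum decompositions and the rank bound\<close>

lemma minimal_zero_sum_exists:
  fixes f :: "'a \<Rightarrow> nat"
  assumes "N \<noteq> {#}" "n dvd (\<Sum>x\<in>#N. f x)"
  shows "\<exists>T. T \<subseteq># N \<and> T \<noteq> {#} \<and> n dvd (\<Sum>x\<in>#T. f x) \<and>
    (\<forall>U. U \<subset># T \<longrightarrow> U \<noteq> {#} \<longrightarrow> \<not> n dvd (\<Sum>x\<in>#U. f x))"
  using assms
proof (induction "size N" arbitrary: N rule: less_induct)
  case less
  show ?case
  proof (cases "\<exists>U. U \<subset># N \<and> U \<noteq> {#} \<and> n dvd (\<Sum>x\<in>#U. f x)")
    case True
    then obtain U where U: "U \<subset># N" "U \<noteq> {#}" "n dvd (\<Sum>x\<in>#U. f x)" by blast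
    show ?thesis
      using less.hyps[OF mset_subset_size[OF U(1)] U(2,3)] U(1)
      by (meson subset_mset.less_imp_le subset_mset.order_trans)
  next
    case False
    then show ?thesis using less.prems by blast
  qed
qed

text \<open>Zero-sum pieces are split off until none is left.\<close>

lemma zero_sum_complement_exists:
  fixes f :: "'a \<Rightarrow> nat"
  shows "\<exists>Z. Z \<subseteq># D \<and> n dvd (\<Sum>x\<in>#Z. f x) \<and> zero_sum_free n f (D - Z)"
proof (induction "size D" arbitrary: D rule: less_induct)
  case less
  show ?case
  proof (cases "zero_sum_free n f D")
    case True
    then show ?thesis by (intro exI[of _ "{#}"]) simp
  next
    case False
    then obtain N where N: "N \<subseteq># D" "N \<noteq> {#}" "n dvd (\<Sum>x\<in>#N. f x)"
      by (auto simp: zero_sum_free_def)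
    then have "size (D - N) < size D"
      using size_mset_mono[OF N(1)] by (simp add: size_Diff_submset nonempty_has_size)
    then obtain Z where Z: "Z \<subseteq># D - N" "n dvd (\<Sum>x\<in>#Z. f x)" "zero_sum_free n f (D - N - Z)"
      using less by blast
    have "N + Z \<subseteq># D" using N(1) Z(1)
      by (simp add: subset_mset.le_diff_conv2 add.commute)
    moreover have "n dvd (\<Sum>x\<in>#N + Z. f x)" using N Z by simp
    ultimately show ?thesis using Z(3) by (metis diff_diff_add_mset)
  qed
qed

context metacyclic_params
begin

text \<open>Minimal zero-sum pieces are split off one at a time; each has rank at least its size,
  and superadditivity adds up these bounds.\<close>

lemma rank_zero_sum:
  assumes "free E" "m dvd xsum E"
  shows "size E \<le> rank E"
  using assms
proof (induction "size E" arbitrary: E rule: less_induct)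
  case less
  show ?case
  proof (cases "E = {#}")
    case False
    then obtain T where T: "T \<subseteq># E" "T \<noteq> {#}" "m dvd xsum T"
      "\<And>U. U \<subset># T \<Longrightarrow> U \<noteq> {#} \<Longrightarrow> \<not> m dvd xsum U"
      using minimal_zero_sum_exists[OF False less.prems(2)] by blast
    define F where "F = E - T"
    have E: "E = T + F" using T(1) by (simp add: F_def)
    have "m dvd xsum F" using less.prems(2) T(3) by (simp add: E dvd_add_right_iff)
    moreover have "size F < size E" using T(2) by (simp add: E nonempty_has_size)
    moreover have "free F" "free T" using less.prems(1) free_mono by (auto simp: E)
    ultimately have "size F \<le> rank F" using less.hyps by blast
    moreover have "size T \<le> rank T"
      using rank_minimal_zero_sum[OF \<open>free T\<close> T(3,2)] T(4) by blast
    ultimately show ?thesis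
      using rank_superadditive[of T F] less.prems(1) by (simp add: E)
  qed simp
qed

text \<open>Enlarge \<open>E\<close> by a zero-sum \<open>Z\<close> so that the rest
  \<open>R\<close> is zero-sum free. The size of \<open>E + Z\<close> is at most its rank, hence at
  most \<open>rank D\<close>, so \<open>R\<close> has at least \<open>m - 1\<close> terms; zero-sum
  freeness allows no more. Prescribing \<open>E\<close> is what makes later exchanges
  possible.\<close>

lemma zero_sum_free_remainder:
  assumes "free D" "rank D + (m - 1) \<le> size D" "E \<subseteq># D" "m dvd xsum E"
  shows "\<exists>R. R \<subseteq># D - E \<and> zero_sum_free m fst R \<and> size R = m - 1 \<and> m dvd xsum (D - R)"
proof -
  obtain Z where Z: "Z \<subseteq># D - E" "m dvd xsum Z" "zero_sum_free m fst (D - E - Z)"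
    using zero_sum_complement_exists by blast
  define R where "R = D - E - Z"
  have D: "D = (E + Z) + R"
    using assms(3) Z(1) by (metis R_def subset_mset.add_diff_inverse union_assoc)
  have zero: "m dvd xsum (E + Z)" using assms(4) Z(2) by simp
  have "size (E + Z) \<le> rank (E + Z)"
    by (rule rank_zero_sum[OF _ zero]) (use free_mono[OF assms(1)] D in auto)
  also have "\<dots> \<le> rank D" by (rule rank_mono[OF assms(1)]) (use D in auto)
  finally have "size (E + Z) + (m - 1) \<le> size D" using assms(2) by simp
  moreover have "size D = size (E + Z) + size R" by (metis D size_union)
  moreover have "size R < m"
    using zero_sum_free_size[OF Z(3)] m_ge_2 by (simp add: R_def)
  ultimately have "size R = m - 1" by linarith
  moreover have "D - R = E + Z" by (metis D add_diff_cancel_right')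
  ultimately show ?thesis using zero Z(3) R_def by (metis diff_subset_eq_self)
qed

end

subsection \<open>The structure of maximal product-one free multisets\<close>

lemma submultiset_of_size_exists:
  assumes "k \<le> size M"
  shows "\<exists>K. K \<subseteq># M \<and> size K = k"
proof -
  obtain xs where xs: "M = mset xs" using ex_mset by metis
  have "mset (take k xs) \<subseteq># M"
    using mset_segment_subset[of 0 k xs] by (simp add: xs)
  moreover have "size (mset (take k xs)) = k" using assms by (simp add: xs)
  ultimately show ?thesis by blast
qed

lemma subset_mset_size_eq: "A \<subseteq># B \<Longrightarrow> size B \<le> size A \<Longrightarrow> A = B"
  using mset_subset_size by (metis linorder_not_less subset_mset.le_neq_trans)

context metacyclic_params
begin

lemma xsum_const: "(\<And>g. g \<in># M \<Longrightarrow> fst g = i) \<Longrightarrow> xsum M = size M * i"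
  by (induction M) auto

text \<open>The length is maximal, which forces a constant exponent. If it had a common divisor
  \<open>d > 1\<close> with \<open>m\<close>, then \<open>m div d\<close> terms, at most
  \<open>m - 1\<close>, would already sum to zero.\<close>

lemma zero_sum_free_fst_const:
  fixes R :: "(nat \<times> nat) multiset"
  assumes "zero_sum_free m fst R" "size R = m - 1" and "\<And>g. g \<in># R \<Longrightarrow> fst g < m"
  obtains i where "\<And>g. g \<in># R \<Longrightarrow> fst g = i" "coprime i m" "i < m"
proof -
  have "R \<noteq> {#}" using assms(2) m_ge_2 by auto
  then obtain h where h: "h \<in># R" by auto
  have const: "fst g = fst h" if "g \<in># R" for g
    using zero_sum_free_maximal_const[OF assms(1) _ assms(2) that h] assms(3)[OF that] assms(3)[OF h]
      m_ge_2 by (simp add: cong_def)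
  have "coprime (fst h) m"
  proof (rule ccontr)
    assume "\<not> coprime (fst h) m"
    then have d: "gcd (fst h) m > 1"
      using m_ge_2 by (metis coprime_iff_gcd_eq_1 gcd_eq_0_iff less_one nat_neq_iff not_numeral_le_zero)
    define k where "k = m div gcd (fst h) m"
    have m: "m = k * gcd (fst h) m" by (simp add: k_def)
    have k: "0 < k" "k < m" using m d m_ge_2 by (auto simp: k_def div_greater_zero_iff)
    then have "k \<le> size R" using assms(2) by simp
    then obtain K where K: "K \<subseteq># R" "size K = k"
      using submultiset_of_size_exists by blast
    have "xsum K = k * fst h" by (metis K const mset_subset_eqD xsum_const)
    then have "m dvd xsum K" by (metis m mult_dvd_mono dvd_refl gcd_dvd1)
    moreover have "K \<noteq> {#}" using K k by auto
    ultimately show False using assms(1) K unfolding zero_sum_free_def by blast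
  qed
  then show thesis using that const assms(3)[OF h] by blast
qed

text \<open>Replacing \<open>T\<close> by other zero-sum submultisets of \<open>T + R\<close> leaves, by the rank bound, a remainder
  of size \<open>m - 1\<close>. Its constant first exponent \<open>i\<close> is determined by the total exponent
  of \<open>T + R\<close>.\<close>

lemma block_const:
  assumes free: "free (T + R)" and less: "\<And>g. g \<in># T + R \<Longrightarrow> fst g < m"
    and R: "zero_sum_free m fst R" "size R = m - 1"
    and T: "m dvd xsum T" "\<And>U. U \<subset># T \<Longrightarrow> U \<noteq> {#} \<Longrightarrow> \<not> m dvd xsum U"
    and g: "g \<in># T" "fst g \<noteq> 0"
    and rank: "rank (T + R) \<le> size T"
  shows "size T = m" and "\<exists>i. coprime i m \<and> (\<forall>h\<in>#T + R. fst h = i)"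
proof -
  define D where "D = T + R"
  obtain i where i: "\<And>h. h \<in># R \<Longrightarrow> fst h = i" "coprime i m" "i < m"
    using zero_sum_free_fst_const[OF R] less by auto
  \<comment> \<open>Since \<open>m - 1\<close> is invertible modulo \<open>m\<close>, the exponent
    \<open>i\<close> can be recovered from \<open>(m - 1) * i\<close>.\<close>
  have coprime_pred: "coprime (m - 1) m"
    using m_ge_2 by (metis One_nat_def Suc_leD coprime_diff_one_left_nat numeral_2_eq_2 less_eq_Suc_le)
  have xsum_D: "[xsum D = (m - 1) * i] (mod m)"
  proof -
    have "[xsum T + (m - 1) * i = 0 + (m - 1) * i] (mod m)"
      using T(1) by (intro cong_add cong_refl) (simp add: cong_0_iff)
    then show ?thesis using xsum_const[of R i] i(1) R(2) by (simp add: D_def)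
  qed
  have remainder: "\<exists>R'. E + R' \<subseteq># D \<and> size R' = m - 1 \<and> (\<forall>h\<in>#R'. fst h = i)"
    if E: "E \<subseteq># D" "m dvd xsum E" for E
  proof -
    obtain R' where R': "R' \<subseteq># D - E" "zero_sum_free m fst R'" "size R' = m - 1" "m dvd xsum (D - R')"
      using zero_sum_free_remainder[of D E] free rank R(2) E by (auto simp: D_def)
    have sub: "R' \<subseteq># D" using R'(1) by (meson diff_subset_eq_self subset_mset.order_trans)
    then obtain j where j: "\<And>h. h \<in># R' \<Longrightarrow> fst h = j" "j < m"
      using zero_sum_free_fst_const[OF R'(2,3)] less by (metis D_def mset_subset_eqD)
    have "xsum D = xsum (D - R') + (m - 1) * j"
      using xsum_const[of R' j] j(1) R'(3) sub
      by (metis image_mset_union subset_mset.diff_add sum_mset.union)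
    then have "[xsum D = 0 + (m - 1) * j] (mod m)"
      using R'(4) by (metis cong_0_iff cong_add_rcancel_nat)
    then have "[(m - 1) * i = (m - 1) * j] (mod m)"
      using xsum_D by (metis add_0 cong_sym cong_trans)
    then have "[i = j] (mod m)" using cong_mult_lcancel_nat[OF coprime_pred] by simp
    then have "i = j" using i(3) j(2) by (simp add: cong_def)
    moreover have "E + R' \<subseteq># D" using R'(1) E(1)
      by (simp add: subset_mset.le_diff_conv2 add.commute)
    ultimately show ?thesis using j(1) R'(3) by blast
  qed
  obtain c where c: "[i * c = Suc 0] (mod m)" using cong_solve_coprime_nat[OF i(2)] by blast
  \<comment> \<open>With \<open>c\<close> inverse to \<open>i\<close>, this is the number of terms
    of exponent \<open>i\<close> that complete \<open>g\<close> to a zero sum. It is positive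
    because \<open>fst g\<close> is nonzero.\<close>
  define k where "k = ((m - fst g) * c) mod m"
  have "[k * i = ((m - fst g) * c) * i] (mod m)"
    by (intro cong_mult cong_refl) (simp add: k_def)
  also have "((m - fst g) * c) * i = (m - fst g) * (i * c)" by simp
  also have "[(m - fst g) * (i * c) = (m - fst g) * Suc 0] (mod m)"
    by (intro cong_mult cong_refl c)
  finally have "[fst g + k * i = fst g + (m - fst g)] (mod m)"
    by (simp add: cong_add_lcancel_nat)
  moreover have "fst g < m" using less g(1) by simp
  ultimately have zero: "m dvd fst g + k * i" by (simp add: cong_def mod_eq_0_iff_dvd)
  have "k \<noteq> 0"
  proof
    assume "k = 0"
    then have "m dvd fst g" using zero by simp
    then show False using \<open>fst g < m\<close> g(2) by (simp add: nat_dvd_not_less)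
  qed
  have "k < m" using m_ge_2 by (simp add: k_def)
  have "k \<le> size R" using R(2) \<open>k < m\<close> by simp
  then obtain K where K: "K \<subseteq># R" "size K = k"
    using submultiset_of_size_exists by blast
  have K_const: "fst h = i" if "h \<in># K" for h using i(1) K(1) that mset_subset_eqD by metis
  have "{#g#} + K \<subseteq># D" unfolding D_def
    using g(1) K(1) by (intro subset_mset.add_mono) simp_all
  moreover have "m dvd xsum ({#g#} + K)"
    using zero xsum_const[of K i] K_const K(2) by simp
  ultimately obtain R1 where R1: "{#g#} + K + R1 \<subseteq># D" "size R1 = m - 1" "\<forall>h\<in>#R1. fst h = i"
    using remainder by blast
  \<comment> \<open>Besides \<open>K\<close>, the remainder \<open>R1\<close> supplies
    \<open>m - 1\<close> terms of exponent \<open>i\<close>. Any \<open>m\<close> of these terms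
    form a zero sum \<open>E\<close>, and the remainder \<open>R2\<close> for \<open>E\<close>
    brings the count to \<open>2 * m - 1\<close>.\<close>
  have "m \<le> size (K + R1)" using K(2) R1(2) \<open>k \<noteq> 0\<close> by simp
  then obtain E where E: "E \<subseteq># K + R1" "size E = m"
    using submultiset_of_size_exists by blast
  have E_const: "fst h = i" if "h \<in># E" for h
  proof -
    have "h \<in># K \<or> h \<in># R1" using mset_subset_eqD[OF E(1) that] by simp
    then show ?thesis using K_const R1(3) by blast
  qed
  have "K + R1 \<subseteq># D" using R1(1)
    by (metis add.assoc mset_subset_eq_add_right subset_mset.order_trans)
  then have "E \<subseteq># D" using E(1) by (rule subset_mset.order_trans[rotated])
  moreover have "m dvd xsum E" using xsum_const[of E i] E_const E(2) by simp
  ultimately obtain R2 where R2: "E + R2 \<subseteq># D" "size R2 = m - 1" "\<forall>h\<in>#R2. fst h = i"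
    using remainder by blast
  \<comment> \<open>By minimality \<open>T\<close> without \<open>g\<close> is zero-sum free, so
    \<open>T\<close> has at most \<open>m\<close> terms. Comparing sizes, \<open>E + R2\<close> must
    then exhaust \<open>D\<close>.\<close>
  have "zero_sum_free m fst (T - {#g#})"
    unfolding zero_sum_free_def
  proof (intro allI impI)
    fix U assume U: "U \<subseteq># T - {#g#}" "U \<noteq> {#}"
    have "T - {#g#} \<subset># T" using g(1) by (simp add: mset_subset_diff_self)
    then have "U \<subset># T" using U(1) by (rule subset_mset.le_less_trans[rotated])
    then show "\<not> m dvd xsum U" using T(2) U(2) by blast
  qed
  then have "size (T - {#g#}) < m" by (rule zero_sum_free_size) (use m_ge_2 in simp)
  then have "size T \<le> m" using g(1) by (simp add: size_Diff_singleton)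
  moreover have "size (E + R2) \<le> size D" using R2(1) by (rule size_mset_mono)
  ultimately show "size T = m" using E(2) R2(2) R(2) by (simp add: D_def)
  then have "E + R2 = D"
    using E(2) R2(2) R(2) by (intro subset_mset_size_eq[OF R2(1)]) (simp add: D_def)
  then show "\<exists>i. coprime i m \<and> (\<forall>h\<in>#T + R. fst h = i)"
    using i(2) E_const R2(3) by (metis D_def union_iff)
qed

end

subsection \<open>Choosing one summand from each of several multisets\<close>

text \<open>For \<open>u = s^i\<close> this is the \<open>y\<close>-exponent of a product of factors
  \<open>x^i y^b\<close>: each \<open>b\<close> is multiplied by one \<open>u\<close> for every
  later factor.\<close>

primrec weighted_sum :: "int \<Rightarrow> nat list \<Rightarrow> int" where
  "weighted_sum u [] = 0"
| "weighted_sum u (b # bs) = int b * u ^ length bs + weighted_sum u bs"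

text \<open>The position of a multiset in the list fixes the weight of its summand, so these values
  form an iterated sumset, suited to Cauchy--Davenport.\<close>

primrec choice_sums :: "int \<Rightarrow> nat multiset list \<Rightarrow> int set" where
  "choice_sums u [] = {0}"
| "choice_sums u (M # Ms) = (\<lambda>b. int b * u ^ length Ms) ` set_mset M + choice_sums u Ms"

lemma yexp_const_fst: "yexp s (map (Pair i) bs) = weighted_sum (int s ^ i) bs"
  by (induction bs) (simp_all add: comp_def sum_list_triv mult.commute flip: power_mult)

lemma choice_sumsD:
  "x \<in> choice_sums u Ms \<Longrightarrow> \<exists>bs. length bs = length Ms \<and> mset bs \<subseteq># sum_list Ms \<and> x = weighted_sum u bs"
proof (induction Ms arbitrary: x)
  case (Cons M Ms)
  then obtain b y where b: "b \<in># M" "y \<in> choice_sums u Ms" "x = int b * u ^ length Ms + y"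
    by (auto simp: set_plus_def)
  then obtain bs where bs: "length bs = length Ms" "mset bs \<subseteq># sum_list Ms" "y = weighted_sum u bs"
    using Cons.IH by blast
  have "{#b#} + mset bs \<subseteq># M + sum_list Ms"
    using b(1) bs(2) by (intro subset_mset.add_mono) simp_all
  then show ?case using b bs by (intro exI[of _ "b # bs"]) simp
qed simp

lemma choice_sums_nonempty: "\<forall>M\<in>set Ms. M \<noteq> {#} \<Longrightarrow> choice_sums u Ms \<noteq> {}"
proof (induction Ms)
  case (Cons M Ms)
  then obtain b y where "b \<in># M" "y \<in> choice_sums u Ms" by fastforce
  then show ?case by (auto simp: set_plus_def)
qed simp

lemma card_mod_pair:
  assumes "\<not> p dvd x - y" shows "card_mod p {x, y} = 2"
  using assms by (simp add: card_mod_def mod_eq_dvd_iff)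

text \<open>The weight of each pair is a unit modulo \<open>p\<close>, so the pair still offers two
  residues, and Cauchy--Davenport gains one residue per pair.\<close>

lemma card_mod_choice_sums_append:
  assumes "prime p" "\<not> p dvd u"
    and "\<forall>M\<in>set Ps. \<exists>a c. M = {#a, c#} \<and> \<not> p dvd int a - int c"
    and "\<forall>M\<in>set Ms. M \<noteq> {#}"
  shows "min (nat p) (card_mod p (choice_sums u Ms) + length Ps) \<le> card_mod p (choice_sums u (Ps @ Ms))"
  using assms(3)
proof (induction Ps)
  case (Cons P Ps)
  let ?C = "choice_sums u (Ps @ Ms)"
  obtain a c where P: "P = {#a, c#}" "\<not> p dvd int a - int c" using Cons.prems by auto
  define w where "w = u ^ length (Ps @ Ms)"
  have "\<not> p dvd w" using assms(1,2) unfolding w_def by (metis prime_dvd_power)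
  then have "\<not> p dvd int a * w - int c * w"
    using P(2) assms(1) by (metis left_diff_distrib prime_dvd_mult_iff)
  then have "card_mod p {int a * w, int c * w} = 2" by (rule card_mod_pair)
  moreover have "choice_sums u ((P # Ps) @ Ms) = {int a * w, int c * w} + ?C"
    by (simp add: P(1) w_def insert_commute)
  moreover have "?C \<noteq> {}"
    by (rule choice_sums_nonempty) (use Cons.prems assms(4) in auto)
  ultimately have "min (nat p) (2 + card_mod p ?C - 1) \<le> card_mod p (choice_sums u ((P # Ps) @ Ms))"
    using cauchy_davenport[OF assms(1), of "{int a * w, int c * w}" ?C] by simp
  moreover have "min (nat p) (card_mod p (choice_sums u Ms) + length Ps) \<le> card_mod p ?C"
    using Cons by simp
  ultimately show ?case by simp
qed simp

text \<open>Besides the differences within a pair, a collision needs \<open>x - y\<close> to equal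
  \<open>z - w\<close> up to sign; the difference of squares excludes both signs at once.\<close>

lemma card_mod_two_pairs:
  assumes "prime p" "\<not> p dvd x - y" "\<not> p dvd z - w" "\<not> p dvd (x - y) ^ 2 - (z - w) ^ 2"
  shows "card_mod p {x + z, x + w, y + z, y + w} = 4"
proof -
  have "(x - y) ^ 2 - (z - w) ^ 2 = ((x - y) - (z - w)) * ((x - y) + (z - w))"
    by (simp add: power2_eq_square algebra_simps)
  then have "\<not> p dvd (x - y) - (z - w)" "\<not> p dvd (x - y) + (z - w)"
    using assms(4) by (metis dvd_mult dvd_mult2)+
  then have "\<not> p dvd (x + w) - (y + z)" "\<not> p dvd (x + z) - (y + w)"
    by (simp_all add: algebra_simps)
  moreover have "\<not> p dvd (x + z) - (x + w)" "\<not> p dvd (x + z) - (y + z)"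
    "\<not> p dvd (x + w) - (y + w)" "\<not> p dvd (y + z) - (y + w)"
    using assms(2,3) by simp_all
  ultimately have "(x + w) mod p \<noteq> (y + z) mod p" "(x + z) mod p \<noteq> (y + w) mod p"
    "(x + z) mod p \<noteq> (x + w) mod p" "(x + z) mod p \<noteq> (y + z) mod p"
    "(x + w) mod p \<noteq> (y + w) mod p" "(y + z) mod p \<noteq> (y + w) mod p"
    unfolding mod_eq_dvd_iff by blast+
  then show ?thesis unfolding card_mod_def by simp
qed

text \<open>Entries are paired at distance \<open>n\<close>, not with their neighbours: in a sorted
  list such a pair has equal entries only if \<open>n + 1\<close> consecutive entries agree. The
  last entry is left over.\<close>

lemma sorted_pairing:
  fixes bs :: "nat list"
  assumes "length bs = 2 * n + 1"
  shows "mset bs = sum_list (map (\<lambda>j. {#bs ! j, bs ! (j + n)#}) [0..<n]) + {#bs ! (2 * n)#}"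
proof -
  have "[0..<2 * n + 1] = [0..<n] @ map (\<lambda>j. j + n) [0..<n] @ [2 * n]"
    by (simp add: map_add_upt mult_2 flip: upt_add_eq_append[of 0 n n])
  then have "bs = map ((!) bs) ([0..<n] @ map (\<lambda>j. j + n) [0..<n] @ [2 * n])"
    using assms by (metis map_nth)
  then have "mset bs = mset (map ((!) bs) ([0..<n] @ map (\<lambda>j. j + n) [0..<n] @ [2 * n]))"
    by (rule arg_cong)
  also have "\<dots> = image_mset ((!) bs) (mset [0..<n]) + image_mset (\<lambda>j. bs ! (j + n)) (mset [0..<n])
      + {#bs ! (2 * n)#}"
    by (simp add: comp_def image_mset.compositionality del: mset_upt)
  also have "image_mset ((!) bs) (mset [0..<n]) + image_mset (\<lambda>j. bs ! (j + n)) (mset [0..<n])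
      = sum_list (map (\<lambda>j. {#bs ! j, bs ! (j + n)#}) [0..<n])"
  proof -
    have "image_mset f (mset xs) + image_mset g (mset xs) = sum_list (map (\<lambda>j. {#f j, g j#}) xs)"
      for f g :: "nat \<Rightarrow> nat" and xs
      by (induction xs) auto
    then show ?thesis by this
  qed
  finally show ?thesis .
qed

section \<open>The rank of a block with constant \<open>x\<close>-exponent\<close>

context metacyclic_params
begin

text \<open>Sort the second exponents \<open>b\<^sub>0 \<le> b\<^sub>1 \<le> \<dots>\<close>. The \<open>m\<close>-th power of an element outside the normal
  subgroup is trivial, so the entries at distance \<open>m - 1\<close> differ and form \<open>m - 1\<close> pairs. One free
  choice from each pair gives \<open>m\<close> values. For \<open>m \<ge> 3\<close> one more arises by placing two of the pairs so
  that their scaled differences do not agree up to sign.\<close>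

lemma const_block_rank:
  assumes free: "free D" and size: "size D = 2 * m - 1"
    and D: "\<And>g. g \<in># D \<Longrightarrow> fst g = i \<and> snd g < q" and i: "coprime i m"
    and mq: "(m, q) \<noteq> (2, 3)"
  shows "m < rank D"
proof (rule ccontr)
  assume "\<not> m < rank D"
  define u where "u = int s ^ i"
  \<comment> \<open>As \<open>i\<close> is coprime to \<open>m\<close>, the power \<open>u\<close>
    of \<open>s\<close> again has order \<open>m\<close> modulo \<open>q\<close>.\<close>
  have u_iff: "[u ^ a = u ^ b] (mod int q) \<longleftrightarrow> [a = b] (mod m)" for a b
    using power_cong_iff[of "i * a" "i * b"] cong_mult_lcancel_nat[OF i]
    by (simp add: u_def power_mult)
  have u_nz: "\<not> int q dvd u"
    using coprime_q_s prime_int_q unfolding u_def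
    by (metis coprime_absorb_left coprime_int_iff coprime_power_right_iff not_prime_unit)
  define bs where "bs = sorted_list_of_multiset (image_mset snd D)"
  have bs: "mset bs = image_mset snd D" "sorted bs" by (simp_all add: bs_def)
  have len: "length bs = 2 * m - 1"
    using size bs(1) by (metis size_image_mset size_mset)
  have D_bs: "D = image_mset (Pair i) (mset bs)"
  proof -
    have "image_mset (Pair i \<circ> snd) D = image_mset id D"
      by (rule image_mset_cong) (use D in \<open>auto simp: prod_eq_iff\<close>)
    then show ?thesis by (simp add: bs(1) image_mset.compositionality)
  qed
  have bs_less: "b < q" if "b \<in> set bs" for b
    using that bs(1) D by (metis (no_types, lifting) image_iff set_image_mset set_mset_mset)
  have neq_iff: "\<not> int q dvd int a - int c" if "a \<in> set bs" "c \<in> set bs" "a \<noteq> c" for a c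
    using bs_less that by (simp flip: mod_eq_dvd_iff)
  have val: "weighted_sum u cs \<in> vals D \<and> \<not> int q dvd weighted_sum u cs"
    if "length cs = m" "mset cs \<subseteq># mset bs" for cs
  proof -
    have sub: "mset (map (Pair i) cs) \<subseteq># D"
      unfolding D_bs mset_map by (rule image_mset_subseteq_mono[OF that(2)])
    have "xexp (map (Pair i) cs) = m * i" using that(1) by (simp add: comp_def sum_list_triv)
    then have dvd: "m dvd xexp (map (Pair i) cs)" by simp
    have "map (Pair i) cs \<noteq> []" using that(1) m_ge_2 by auto
    from freeD[OF free this sub dvd] have "\<not> int q dvd yexp s (map (Pair i) cs)" .
    moreover have "yexp s (map (Pair i) cs) \<in> vals D"
      unfolding vals_def using sub dvd by blast
    ultimately show ?thesis by (simp add: yexp_const_fst u_def)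
  qed
  \<comment> \<open>Products of \<open>m\<close> terms lie in the normal subgroup and are nontrivial
    by freeness, so together with \<open>0\<close> they give at most \<open>rank D + 1\<close>
    residues.\<close>
  have rank_bound: "card_mod (int q) W \<le> m"
    if W: "\<And>x. x \<in> W \<Longrightarrow> \<exists>cs. length cs = m \<and> mset cs \<subseteq># mset bs \<and> [x = weighted_sum u cs] (mod int q)" for W
  proof -
    have "insert 0 ((\<lambda>a. a mod int q) ` W) \<subseteq> (\<lambda>a. a mod int q) ` vals D"
    proof
      fix y assume "y \<in> insert 0 ((\<lambda>a. a mod int q) ` W)"
      then show "y \<in> (\<lambda>a. a mod int q) ` vals D"
      proof
        assume "y = 0"
        then show ?thesis using zero_in_vals[of D] by force
      next
        assume "y \<in> (\<lambda>a. a mod int q) ` W"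
        then obtain x where "x \<in> W" "y = x mod int q" by blast
        then obtain cs where "length cs = m" "mset cs \<subseteq># mset bs" "y = weighted_sum u cs mod int q"
          using W unfolding cong_def by metis
        then show ?thesis using val by blast
      qed
    qed
    then have "card (insert 0 ((\<lambda>a. a mod int q) ` W)) \<le> Suc (rank D)"
      using card_mono finite_residues q_pos card_mod_vals[of D] by (metis card_mod_def of_nat_0_less_iff)
    moreover have "0 \<notin> (\<lambda>a. a mod int q) ` W"
    proof
      assume "0 \<in> (\<lambda>a. a mod int q) ` W"
      then obtain x where "x \<in> W" "int q dvd x" by auto
      then show False using W val by (metis cong_dvd_iff cong_sym)
    qed
    moreover have "finite ((\<lambda>a. a mod int q) ` W)" using finite_residues q_pos by simp
    ultimately show ?thesis using \<open>\<not> m < rank D\<close> by (simp add: card_mod_def)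
  qed
  have u_minus_1: "\<not> int q dvd u - 1"
    using u_iff[of 1 0] m_ge_2 by (simp add: cong_iff_dvd_diff) (simp add: cong_def)
  have pair_neq: "bs ! j \<noteq> bs ! (j + (m - 1))" if j: "j < m" for j
  proof
    assume eq: "bs ! j = bs ! (j + (m - 1))"
    define cs where "cs = drop j (take (j + m) bs)"
    have lc: "length cs = m" using j len by (simp add: cs_def)
    have "cs = replicate m (bs ! j)"
    proof (rule nth_equalityI)
      fix k assume "k < length cs"
      then have k: "k < m" using lc by simp
      have "bs ! j \<le> bs ! (j + k)" "bs ! (j + k) \<le> bs ! (j + (m - 1))"
        by (rule sorted_nth_mono[OF bs(2)]; use k j len in simp)+
      then have "bs ! (j + k) = bs ! j" using eq by simp
      then show "cs ! k = replicate m (bs ! j) ! k" using k len j by (simp add: cs_def)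
    qed (simp add: lc)
    then have ws: "weighted_sum u cs = weighted_sum u (replicate m (bs ! j))" by simp
    \<comment> \<open>The geometric sum: for \<open>n = m\<close> the right side vanishes modulo
      \<open>q\<close> while \<open>u - 1\<close> does not, so \<open>m\<close> equal entries would
      have trivial product.\<close>
    have "(u - 1) * weighted_sum u (replicate n b) = int b * (u ^ n - 1)" for n b
      by (induction n) (simp_all add: algebra_simps)
    moreover have "int q dvd u ^ m - 1"
      using u_iff[of m 0] by (simp add: cong_iff_dvd_diff) (simp add: cong_def)
    ultimately have "int q dvd (u - 1) * weighted_sum u cs" by (simp add: ws)
    then have "int q dvd weighted_sum u cs"
      using u_minus_1 prime_int_q prime_dvd_mult_iff by blast
    moreover have "mset cs \<subseteq># mset bs" unfolding cs_def by (rule mset_segment_subset)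
    ultimately show False using val lc by blast
  qed
  define Ps where "Ps = map (\<lambda>j. {#bs ! j, bs ! (j + (m - 1))#}) [0..<m - 1]"
  define L where "L = {#bs ! (2 * (m - 1))#}"
  have "length bs = 2 * (m - 1) + 1" using len m_ge_2 by simp
  then have mset_bs: "mset bs = sum_list Ps + L"
    unfolding Ps_def L_def by (rule sorted_pairing)
  have Ps: "\<exists>a c. P = {#a, c#} \<and> a \<in> set bs \<and> c \<in> set bs \<and> \<not> int q dvd int a - int c" if P: "P \<in> set Ps" for P
  proof -
    obtain j where j: "j < m - 1" "P = {#bs ! j, bs ! (j + (m - 1))#}"
      using P unfolding Ps_def set_map set_upt by auto
    have "bs ! j \<in> set bs" "bs ! (j + (m - 1)) \<in> set bs" using j len by simp_all
    moreover have "bs ! j \<noteq> bs ! (j + (m - 1))" using pair_neq[of j] j(1) by linarith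
    ultimately show ?thesis using j(2) neq_iff by blast
  qed
  show False
  proof (cases "m = 2")
    case False
    then have m3: "m \<ge> 3" using m_ge_2 by simp
    have choice_bound: "card_mod (int q) (choice_sums u Ms) \<le> m"
      if "length Ms = m" "sum_list Ms = mset bs" for Ms
    proof (rule rank_bound)
      fix x assume "x \<in> choice_sums u Ms"
      then show "\<exists>cs. length cs = m \<and> mset cs \<subseteq># mset bs \<and> [x = weighted_sum u cs] (mod int q)"
        using choice_sumsD[of x u Ms] that by auto
    qed
    have lenPs: "length Ps = m - 1" by (simp add: Ps_def)
    then obtain P1 P2 Qs where Ps_eq: "Ps = P1 # P2 # Qs"
      using m3 by (cases Ps; cases "tl Ps") auto
    have lenQs: "length Qs + 3 = m" using lenPs m3 by (simp add: Ps_eq)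
    obtain a1 c1 where P1: "P1 = {#a1, c1#}" "\<not> int q dvd int a1 - int c1"
      using Ps[of P1] by (auto simp: Ps_eq)
    obtain a2 c2 where P2: "P2 = {#a2, c2#}" "\<not> int q dvd int a2 - int c2"
      using Ps[of P2] by (auto simp: Ps_eq)
    \<comment> \<open>Four residues from the last three places would grow to \<open>m + 1\<close>
      through the \<open>m - 3\<close> pairs in \<open>Qs\<close>, contradicting
      \<open>choice_bound\<close>; the cap \<open>q\<close> does not interfere as
      \<open>m < q\<close>.\<close>
    have tail: "card_mod (int q) (choice_sums u Ms) < 4"
      if Ms: "length Ms = 3" "sum_list Ms = P1 + P2 + L" "\<forall>M\<in>set Ms. M \<noteq> {#}" for Ms
    proof -
      have "min q (card_mod (int q) (choice_sums u Ms) + length Qs) \<le> card_mod (int q) (choice_sums u (Qs @ Ms))"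
        using card_mod_choice_sums_append[OF prime_int_q u_nz, of Qs Ms] Ps Ms(3)
        by (fastforce simp: Ps_eq)
      also have "\<dots> \<le> m"
        by (rule choice_bound) (use Ms lenQs in \<open>simp_all add: mset_bs Ps_eq ac_simps\<close>)
      finally show ?thesis using lenQs m_less_q by linarith
    qed
    \<comment> \<open>With \<open>P2\<close> in the last place and \<open>P1\<close> weighted by
      \<open>v\<close>, fewer than four residues force the two scaled differences to agree up to
      sign.\<close>
    have four: "int q dvd ((int a1 - int c1) * v) ^ 2 - (int a2 - int c2) ^ 2"
      if Ms: "length Ms = 3" "sum_list Ms = P1 + P2 + L" "\<forall>M\<in>set Ms. M \<noteq> {#}"
        and sub: "\<And>x z. x \<in> {int a1, int c1} \<Longrightarrow> z \<in> {int a2, int c2} \<Longrightarrow> (x * v + r) + z \<in> choice_sums u Ms"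
        and v: "\<not> int q dvd v"
      for Ms v r
    proof (rule ccontr)
      assume not: "\<not> int q dvd ((int a1 - int c1) * v) ^ 2 - (int a2 - int c2) ^ 2"
      have "\<not> int q dvd (int a1 - int c1) * v"
        using P1(2) v prime_int_q prime_dvd_mult_iff by blast
      then have "card_mod (int q) {(int a1 * v + r) + int a2, (int a1 * v + r) + int c2,
          (int c1 * v + r) + int a2, (int c1 * v + r) + int c2} = 4"
        using P2(2) not by (intro card_mod_two_pairs prime_int_q) (simp_all add: left_diff_distrib)
      moreover have "card_mod (int q) {(int a1 * v + r) + int a2, (int a1 * v + r) + int c2,
          (int c1 * v + r) + int a2, (int c1 * v + r) + int c2} \<le> card_mod (int q) (choice_sums u Ms)"
      proof (rule card_mod_mono)
        fix x assume "x \<in> {(int a1 * v + r) + int a2, (int a1 * v + r) + int c2,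
          (int c1 * v + r) + int a2, (int c1 * v + r) + int c2}"
        then have "x \<in> choice_sums u Ms"
          using sub by blast
        then show "\<exists>b\<in>choice_sums u Ms. [x = b] (mod int q)" using cong_refl by blast
      qed (use q_pos in simp)
      ultimately show False using tail[OF Ms] by simp
    qed
    define d1 where "d1 = int a1 - int c1"
    define d2 where "d2 = int a2 - int c2"
    \<comment> \<open>Moving the leftover \<open>L\<close> changes the weight of \<open>P1\<close>
      from \<open>u\<close> to \<open>u ^ 2\<close>. Comparing the two conclusions gives
      \<open>u ^ 2 = 1\<close> modulo \<open>q\<close>, impossible for order \<open>m\<close> at
      least 3.\<close>
    have "int q dvd (d1 * u) ^ 2 - d2 ^ 2"
      unfolding d1_def d2_def
    proof (rule four[of "[L, P1, P2]" u "int (bs ! (2 * (m - 1))) * u ^ 2"])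
      fix x z assume "x \<in> {int a1, int c1}" "z \<in> {int a2, int c2}"
      then show "x * u + int (bs ! (2 * (m - 1))) * u ^ 2 + z \<in> choice_sums u [L, P1, P2]"
        by (auto simp: L_def P1 P2 set_plus_def numeral_2_eq_2)
    qed (use u_nz in \<open>auto simp: L_def P1 P2\<close>)
    moreover have "int q dvd (d1 * u ^ 2) ^ 2 - d2 ^ 2"
      unfolding d1_def d2_def
    proof (rule four[of "[P1, L, P2]" "u ^ 2" "int (bs ! (2 * (m - 1))) * u"])
      fix x z assume "x \<in> {int a1, int c1}" "z \<in> {int a2, int c2}"
      then show "x * u ^ 2 + int (bs ! (2 * (m - 1))) * u + z \<in> choice_sums u [P1, L, P2]"
        by (auto simp: L_def P1 P2 set_plus_def numeral_2_eq_2)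
    next
      show "\<not> int q dvd u ^ 2" using u_nz prime_int_q prime_dvd_power by blast
    qed (auto simp: L_def P1 P2)
    ultimately have "int q dvd ((d1 * u ^ 2) ^ 2 - d2 ^ 2) - ((d1 * u) ^ 2 - d2 ^ 2)"
      by (rule dvd_diff[rotated])
    also have "\<dots> = (d1 * u) ^ 2 * (u ^ 2 - 1)"
      by (simp add: power2_eq_square algebra_simps)
    finally have "int q dvd u ^ 2 - 1"
      using P1(2) u_nz prime_int_q unfolding d1_def[symmetric]
      by (metis prime_dvd_mult_iff prime_dvd_power)
    then have "[2 = 0] (mod m)"
      using u_iff[of 2 0] by (simp add: cong_iff_dvd_diff)
    then show False using m3 by (simp add: cong_def)
  next
    \<comment> \<open>Here \<open>u\<close> is \<open>- 1\<close> modulo \<open>q\<close>, so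
      products of two terms are differences of entries, and at most two residues are available for
      them. The nonzero \<open>x\<close> and \<open>- x\<close> use both, which forces
      \<open>y = - x\<close> and \<open>y - x = x\<close>, hence \<open>3 * x = 0\<close>; but
      \<open>q\<close> is not 3.\<close>
    case m2: True
    have "int q dvd (u - 1) * (u + 1)"
      using u_iff[of 2 0] m2 by (simp add: cong_iff_dvd_diff algebra_simps power2_eq_square) (simp add: cong_def)
    then have "int q dvd u + 1"
      using u_minus_1 prime_int_q prime_dvd_mult_iff by blast
    then have u_neg: "[u = - 1] (mod int q)" by (simp add: cong_iff_dvd_diff)
    obtain b0 b1 b2 where b: "bs = [b0, b1, b2]"
      using len m2 by (auto simp: length_Suc_conv numeral_eq_Suc)
    have neq: "b0 \<noteq> b1" "b1 \<noteq> b2" using pair_neq[of 0] pair_neq[of 1] by (simp_all add: b m2)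
    then have lt: "b0 < b1" "b1 < b2" using bs(2) by (auto simp: b)
    define x where "x = int b1 - int b0"
    define y where "y = int b2 - int b0"
    have "\<exists>cs. length cs = m \<and> mset cs \<subseteq># mset bs \<and> [w = weighted_sum u cs] (mod int q)"
      if w: "w \<in> {x, - x, y, - y, y - x, x - y}" for w
    proof -
      have *: "[int c - int a = weighted_sum u [a, c]] (mod int q)" for a c
      proof -
        have "[int a * u + int c = int a * (- 1) + int c] (mod int q)"
          by (intro cong_add cong_mult cong_refl u_neg)
        then show ?thesis by (simp add: cong_sym)
      qed
      have "w = int b1 - int b0 \<or> w = int b0 - int b1 \<or> w = int b2 - int b0 \<or> w = int b0 - int b2
          \<or> w = int b2 - int b1 \<or> w = int b1 - int b2"
        using w by (auto simp: x_def y_def)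
      moreover have "mset [b0, b1] \<subseteq># mset bs" "mset [b1, b0] \<subseteq># mset bs" "mset [b0, b2] \<subseteq># mset bs"
        "mset [b2, b0] \<subseteq># mset bs" "mset [b1, b2] \<subseteq># mset bs" "mset [b2, b1] \<subseteq># mset bs"
        by (simp_all add: b add_mset_commute)
      ultimately show ?thesis using * m2
        by (metis length_Cons list.size(3) numeral_2_eq_2)
    qed
    then have le2: "card_mod (int q) {x, - x, y, - y, y - x, x - y} \<le> 2"
      using rank_bound[of "{x, - x, y, - y, y - x, x - y}"] m2 by blast
    have q5: "\<not> int q dvd 2" "\<not> int q dvd 3"
    proof -
      have "q \<noteq> 2" "q \<noteq> 3" using m_less_q m2 mq by auto
      moreover have "q > 2" using m_less_q m2 by simp
      ultimately show "\<not> int q dvd 2" "\<not> int q dvd 3" by (auto dest!: zdvd_imp_le)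
    qed
    have ndvd: "\<not> int q dvd x" "\<not> int q dvd y" "\<not> int q dvd y - x"
      using neq_iff[of b1 b0] neq_iff[of b2 b0] neq_iff[of b2 b1] lt by (simp_all add: b x_def y_def)
    have three: "a mod int q = b mod int q \<or> a mod int q = c mod int q \<or> b mod int q = c mod int q"
      if "{a, b, c} \<subseteq> {x, - x, y, - y, y - x, x - y}" for a b c
    proof (rule ccontr)
      assume "\<not> ?thesis"
      then have "card_mod (int q) {a, b, c} = 3" by (simp add: card_mod_def)
      moreover have "card_mod (int q) {a, b, c} \<le> card_mod (int q) {x, - x, y, - y, y - x, x - y}"
        unfolding card_mod_def by (intro card_mono image_mono that) simp
      ultimately show False using le2 by simp
    qed
    have dbl: "\<not> int q dvd x - (- x)"
      using ndvd(1) q5(1) prime_int_q by (metis diff_minus_eq_add mult_2 prime_dvd_mult_iff)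
    have "int q dvd x - y \<or> int q dvd (- x) - y"
      using three[of x "- x" y] dbl unfolding mod_eq_dvd_iff by blast
    then have d1: "int q dvd (- x) - y" using ndvd(3) by (metis dvd_minus_iff minus_diff_eq)
    have "int q dvd x - (y - x) \<or> int q dvd (- x) - (y - x)"
      using three[of x "- x" "y - x"] dbl unfolding mod_eq_dvd_iff by blast
    then have "int q dvd x - (y - x)" using ndvd(2) by auto
    then have "int q dvd (x - (y - x)) - ((- x) - y)" using d1 by (rule dvd_diff)
    then have "int q dvd 3 * x" by (simp add: algebra_simps)
    then show False using q5(2) ndvd(1) prime_int_q prime_dvd_mult_iff by blast
  qed
qed

section \<open>The extremal multisets and the equivalence\<close>

lemma xexp_zero: "\<forall>g\<in>set xs. fst g = 0 \<Longrightarrow> xexp xs = 0"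
  by (induction xs) auto

lemma yexp_of_xexp_zero: "\<forall>g\<in>set xs. fst g = 0 \<Longrightarrow> yexp s xs = int (sum_list (map snd xs))"
  by (induction xs) (simp_all add: xexp_zero)

lemma coprime_m_nonzero: "coprime i m \<Longrightarrow> i \<noteq> 0"
  using m_ge_2 by (cases i) auto

theorem free_maximal_structure:
  assumes free: "free M" and size: "size M = m + q - 2"
    and less: "\<And>g. g \<in># M \<Longrightarrow> fst g < m \<and> snd g < q" and mq: "(m, q) \<noteq> (2, 3)"
  obtains t i X where "1 \<le> t" "t \<le> q - 1" "1 \<le> i" "i \<le> m - 1" "coprime i m"
    "size X = m - 1" "\<And>g. g \<in># X \<Longrightarrow> fst g = i" "M = replicate_mset (q - 1) (0, t) + X"
proof -
  have "rank M + (m - 1) \<le> size M" using rank_less[of M] size m_ge_2 by linarith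
  then obtain R where R: "R \<subseteq># M" "zero_sum_free m fst R" "size R = m - 1" "m dvd xsum (M - R)"
    using zero_sum_free_remainder[OF free, of "{#}"] by auto
  define Z where "Z = M - R"
  have M: "M = Z + R" using R(1) by (simp add: Z_def)
  have sizeZ: "size Z = q - 1" using size R(3) m_ge_2 q_pos by (simp add: M)
  have less_fst: "\<And>g. g \<in># R \<Longrightarrow> fst g < m" using less by (simp add: M)
  have fst0: "fst g = 0" if g: "g \<in># Z" for g
  proof (rule ccontr)
    assume g0: "fst g \<noteq> 0"
    \<comment> \<open>Terms of exponent \<open>0\<close> are one-element zero sums. Discarding them
      first ensures that the minimal zero sum \<open>T\<close> consists of terms outside the normal
      subgroup.\<close>
    define N where "N = filter_mset (\<lambda>g. fst g \<noteq> 0) Z"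
    have "xsum (filter_mset (\<lambda>g. fst g \<noteq> 0) A) = xsum A" for A :: "(nat \<times> nat) multiset"
      by (induction A) auto
    then have "xsum N = xsum Z" unfolding N_def .
    then have "m dvd xsum N" using R(4) by (simp only: Z_def)
    moreover have "g \<in># N" using g g0 by (simp add: N_def)
    then have "N \<noteq> {#}" by auto
    ultimately obtain T where T: "T \<subseteq># N" "T \<noteq> {#}" "m dvd xsum T"
      "\<And>U. U \<subset># T \<Longrightarrow> U \<noteq> {#} \<Longrightarrow> \<not> m dvd xsum U"
      using minimal_zero_sum_exists by blast
    obtain h where h: "h \<in># T" using T(2) by auto
    then have h0: "fst h \<noteq> 0" using mset_subset_eqD[OF T(1) h] by (simp add: N_def)
    have "N \<subseteq># Z" by (simp add: N_def)
    then have "T \<subseteq># Z" using T(1) by (rule subset_mset.order_trans[rotated])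
    define Y where "Y = Z - T"
    have Z: "Z = T + Y" using \<open>T \<subseteq># Z\<close> by (simp add: Y_def)
    have M_TRY: "M = (T + R) + Y" by (simp add: M Z ac_simps)
    have free_TR: "free (T + R)" "free Y" using free_mono[OF free] by (auto simp: M_TRY)
    have "m dvd xsum Y"
      using R(4) T(3) by (simp add: Z dvd_add_right_iff flip: Z_def)
    \<comment> \<open>The part \<open>Y\<close> uses up at least \<open>size Y\<close> of the total
      rank, which is at most \<open>q - 1 = size T + size Y\<close>; so at most
      \<open>size T\<close> is left for \<open>T + R\<close>.\<close>
    then have "size Y \<le> rank Y" using rank_zero_sum free_TR by blast
    moreover have "rank (T + R) + rank Y \<le> rank M"
      using rank_superadditive[of "T + R" Y] free by (simp add: M_TRY)
    moreover have "size T + size Y = q - 1" using sizeZ by (simp add: Z)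
    ultimately have rank: "rank (T + R) \<le> size T" using rank_less[of M] by linarith
    have less_TR: "fst g < m \<and> snd g < q" if "g \<in># T + R" for g
      by (rule less) (use that in \<open>auto simp: M_TRY\<close>)
    note block = block_const[OF free_TR(1) _ R(2,3) T(3,4) h h0 rank]
    have sizeT: "size T = m" by (rule block) (use less_TR in blast)
    have "\<exists>i. coprime i m \<and> (\<forall>h\<in>#T + R. fst h = i)" by (rule block) (use less_TR in blast)
    then obtain i where i: "coprime i m" "\<forall>h\<in>#T + R. fst h = i" by blast
    have "m < rank (T + R)"
      by (rule const_block_rank[OF free_TR(1) _ _ i(1) mq]) (use sizeT R(3) m_ge_2 i(2) less_TR in auto)
    then show False using rank sizeT by simp
  qed
  \<comment> \<open>All terms of \<open>Z\<close> are powers of \<open>y\<close>, so multiplying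
    them adds their second coordinates, and a zero sum would be a product-one list.\<close>
  have "zero_sum_free q snd Z"
    unfolding zero_sum_free_def
  proof (intro allI impI notI)
    fix N assume N: "N \<subseteq># Z" "N \<noteq> {#}" "q dvd (\<Sum>g\<in>#N. snd g)"
    obtain xs where xs: "N = mset xs" using ex_mset by metis
    have "\<forall>g\<in>set xs. fst g = 0" using fst0 mset_subset_eqD[OF N(1)] by (simp add: xs)
    then have "yexp s xs = int (\<Sum>g\<in>#N. snd g) \<and> xexp xs = 0"
      by (simp add: yexp_of_xexp_zero xexp_zero sum_mset_mset_eq_sum_list xs del: mset_map)
    moreover have "mset xs \<subseteq># M" using N(1) by (auto simp: M xs intro: subset_mset.order_trans)
    moreover have "xs \<noteq> []" using N(2) xs by auto
    ultimately show False using freeD[OF free, of xs] N(3)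
      by (metis dvd_0_right of_nat_dvd_iff)
  qed
  note zsf = this
  have "Z \<noteq> {#}" using sizeZ m_less_q m_ge_2 by auto
  then obtain h where h: "h \<in># Z" by auto
  have "g = (0, snd h)" if g: "g \<in># Z" for g
  proof -
    have "[snd g = snd h] (mod q)"
      using zero_sum_free_maximal_const[OF zsf q_pos sizeZ g h] .
    moreover have "snd g < q" "snd h < q" using less g h by (simp_all add: M)
    ultimately have "snd g = snd h" by (simp add: cong_def)
    then show ?thesis using fst0[OF g] by (simp add: prod_eq_iff)
  qed
  then have Z: "Z = replicate_mset (q - 1) (0, snd h)"
    by (metis sizeZ set_mset_subset_singletonD subsetI singleton_iff)
  have "\<not> q dvd snd h"
  proof -
    have "{#h#} \<subseteq># Z" using h by simp
    then show ?thesis using zsf unfolding zero_sum_free_def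
      by (metis empty_not_add_mset image_mset_single sum_mset.singleton)
  qed
  then have "snd h \<noteq> 0" by (metis dvd_0_right)
  moreover have "snd h < q" using less h by (simp add: M)
  moreover obtain i where i: "\<And>g. g \<in># R \<Longrightarrow> fst g = i" "coprime i m" "i < m"
    using zero_sum_free_fst_const[OF R(2,3) less_fst] by blast
  moreover have "i \<noteq> 0" using coprime_m_nonzero[OF i(2)] .
  ultimately show thesis
    using that[of "snd h" i R] R(3) M Z by simp
qed

text \<open>A product-one list using \<open>n\<close> terms of \<open>X\<close> needs
  \<open>m\<close> to divide \<open>n * i\<close>, so \<open>n = 0\<close> because
  \<open>n < m\<close>. What remains is \<open>k\<close> copies of \<open>y^t\<close> with
  \<open>0 < k < q\<close>, and \<open>q\<close> does not divide \<open>k * t\<close>.\<close>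

lemma free_standard:
  assumes i: "coprime i m" and X: "size X = m - 1" "\<And>g. g \<in># X \<Longrightarrow> fst g = i"
    and t: "1 \<le> t" "t \<le> q - 1"
  shows "free (replicate_mset (q - 1) (0, t) + X)"
  unfolding free_def
proof (intro allI impI)
  fix xs
  assume xs: "xs \<noteq> []" "mset xs \<subseteq># replicate_mset (q - 1) (0, t) + X" "m dvd xexp xs"
  define A where "A = filter_mset (\<lambda>g. g = (0, t)) (mset xs)"
  have "i \<noteq> 0" using coprime_m_nonzero[OF i] .
  then have not_X: "(0, t) \<notin># X" using X(2) by fastforce
  define B where "B = filter_mset (\<lambda>g. g \<noteq> (0, t)) (mset xs)"
  have xs_AB: "mset xs = A + B" by (simp add: A_def B_def)
  have "B \<subseteq># filter_mset (\<lambda>g. g \<noteq> (0, t)) (replicate_mset (q - 1) (0, t) + X)"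
    unfolding B_def using xs(2) by (rule multiset_filter_mono)
  also have "\<dots> = filter_mset (\<lambda>g. g \<noteq> (0, t)) X" by (simp add: filter_mset_eq_conv)
  also have "\<dots> \<subseteq># X" by simp
  finally have B: "B \<subseteq># X" .
  have "A = replicate_mset (count (mset xs) (0, t)) (0, t)"
    by (simp add: A_def filter_eq_replicate_mset)
  then obtain k where A: "A = replicate_mset k (0, t)" "k = count (mset xs) (0, t)" by blast
  have "k \<le> count (replicate_mset (q - 1) (0, t) + X) (0, t)"
    unfolding A(2) using xs(2) by (rule mset_subset_eq_count)
  then have k: "k \<le> q - 1" using not_X by (simp add: not_in_iff)
  have "xexp xs = xsum A + xsum B" by (simp add: xs_AB flip: xsum_mset)
  also have "\<dots> = size B * i" using xsum_const[of B i] X(2) B A(1) mset_subset_eqD by (metis (no_types, lifting) add_0 image_replicate_mset fst_conv mult_0_right sum_mset_replicate_mset)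
  finally have "m dvd size B" using xs(3) i by (simp add: coprime_dvd_mult_left_iff coprime_commute)
  moreover have "size B < m" using size_mset_mono[OF B] X(1) m_ge_2 by simp
  ultimately have "B = {#}" by (auto dest: dvd_imp_le)
  then have mset_xs: "mset xs = replicate_mset k (0, t)" using xs_AB A by simp
  then have "xs = replicate k (0, t)"
    by (metis mset_replicate mset_eq_length replicate_length_same set_mset_mset in_replicate_mset length_replicate)
  then have "yexp s xs = int (k * t)"
    using yexp_of_xexp_zero[of xs] by (simp add: sum_list_replicate)
  moreover have "\<not> q dvd k * t"
  proof -
    have "k \<noteq> 0" using xs(1) mset_xs by (intro notI) simp
    then have "\<not> q dvd k" "\<not> q dvd t" using k t q_pos by (auto dest!: dvd_imp_le)
    then show ?thesis using prime_q prime_dvd_mult_iff by blast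
  qed
  ultimately show "\<not> int q dvd yexp s xs" by (metis of_nat_dvd_iff)
qed

section \<open>Translation into powers of the generators\<close>

lemma gen_y_pow: "gen_y [^]\<^bsub>G\<^esub> (n :: nat) = (0, n mod q)"
proof (induction n)
  case (Suc n)
  then show ?case
    by (simp add: nat_pow_def gen_y_def mult_G mod_Suc_eq)
qed (simp add: nat_pow_def one_G)

lemma gen_x_pow: "gen_x [^]\<^bsub>G\<^esub> (n :: nat) = (n mod m, 0)"
proof (induction n)
  case (Suc n)
  then show ?case
    by (simp add: nat_pow_def gen_x_def mult_G mod_Suc_eq)
qed (simp add: nat_pow_def one_G)

lemma gen_product:
  "i < m \<Longrightarrow> n < q \<Longrightarrow> gen_x [^]\<^bsub>G\<^esub> i \<otimes>\<^bsub>G\<^esub> gen_y [^]\<^bsub>G\<^esub> n = (i, n)"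
  by (simp add: gen_x_pow gen_y_pow mult_G)

lemma standard_mset:
  assumes "t \<le> q - 1" "i \<le> m - 1" "\<forall>k\<in>{1..m-1}. \<nu> k \<le> q - 1"
  shows "mset (replicate (q - 1) (gen_y [^]\<^bsub>G\<^esub> t)
            @ map (\<lambda>k. gen_x [^]\<^bsub>G\<^esub> i \<otimes>\<^bsub>G\<^esub> gen_y [^]\<^bsub>G\<^esub> (\<nu> k :: nat)) [1..<m])
       = replicate_mset (q - 1) (0, t) + mset (map (\<lambda>k. (i, \<nu> k)) [1..<m])"
proof -
  have "map (\<lambda>k. gen_x [^]\<^bsub>G\<^esub> i \<otimes>\<^bsub>G\<^esub> gen_y [^]\<^bsub>G\<^esub> \<nu> k) [1..<m] = map (\<lambda>k. (i, \<nu> k)) [1..<m]"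
  proof (rule map_cong[OF refl])
    fix k assume "k \<in> set [1..<m]"
    then have "\<nu> k \<le> q - 1" using assms(3) by auto
    then show "gen_x [^]\<^bsub>G\<^esub> i \<otimes>\<^bsub>G\<^esub> gen_y [^]\<^bsub>G\<^esub> \<nu> k = (i, \<nu> k)"
      using assms(2) q_pos m_ge_2 by (intro gen_product) linarith+
  qed
  moreover have "gen_y [^]\<^bsub>G\<^esub> t = (0, t)" using assms(1) q_pos by (simp add: gen_y_pow)
  ultimately show ?thesis by (simp only: mset_append mset_replicate)
qed

theorem free_maximal_iff:
  assumes mq: "(m, q) \<noteq> (2, 3)" and S: "set S \<subseteq> carrier G" "length S = m + q - 2"
  shows "product_one_free G S \<longleftrightarrow>
    (\<exists>t i \<nu>. 1 \<le> t \<and> t \<le> q - 1 \<and> 1 \<le> i \<and> i \<le> m - 1 \<and> coprime i m \<and>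
       (\<forall>k\<in>{1..m-1}. \<nu> k \<le> q - 1) \<and>
       mset S = mset (replicate (q - 1) (gen_y [^]\<^bsub>G\<^esub> t)
                      @ map (\<lambda>k. gen_x [^]\<^bsub>G\<^esub> i \<otimes>\<^bsub>G\<^esub> gen_y [^]\<^bsub>G\<^esub> (\<nu> k :: nat)) [1..<m]))"
    (is "_ \<longleftrightarrow> ?std")
proof
  assume "product_one_free G S"
  then have free: "free (mset S)" using product_one_free_iff by simp
  have less: "fst g < m \<and> snd g < q" if "g \<in># mset S" for g
    using S(1) that by (auto simp: carrier_G)
  have "size (mset S) = m + q - 2" using S(2) by simp
  from free_maximal_structure[OF free this less mq] obtain t i X where
    *: "1 \<le> t" "t \<le> q - 1" "1 \<le> i" "i \<le> m - 1" "coprime i m"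
    "size X = m - 1" "\<And>g. g \<in># X \<Longrightarrow> fst g = i" "mset S = replicate_mset (q - 1) (0, t) + X"
    by blast
  obtain xs where xs: "X = mset xs" using ex_mset by metis
  \<comment> \<open>The exponents are numbered from 1 and list positions from 0, hence
    \<open>k - 1\<close>.\<close>
  define \<nu> where "\<nu> = (\<lambda>k. snd (xs ! (k - 1)))"
  have len: "length xs = m - 1" using *(6) by (simp add: xs)
  have \<nu>: "\<forall>k\<in>{1..m-1}. \<nu> k \<le> q - 1"
  proof
    fix k assume "k \<in> {1..m - 1}"
    then have "k - 1 < length xs" using len m_ge_2 by auto
    then have "xs ! (k - 1) \<in># mset S" using *(8) by (simp add: xs del: One_nat_def)
    then show "\<nu> k \<le> q - 1" using less by (fastforce simp: \<nu>_def)
  qed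
  have "map (\<lambda>k. (i, \<nu> k)) [1..<m] = xs"
  proof (rule nth_equalityI)
    fix k assume "k < length (map (\<lambda>k. (i, \<nu> k)) [1..<m])"
    then have k: "k < m - 1" by simp
    then have "fst (xs ! k) = i" using *(7) len by (simp add: xs)
    then show "map (\<lambda>k. (i, \<nu> k)) [1..<m] ! k = xs ! k"
      using k by (simp add: \<nu>_def prod_eq_iff)
  qed (simp add: len)
  then have "mset S = replicate_mset (q - 1) (0, t) + mset (map (\<lambda>k. (i, \<nu> k)) [1..<m])"
    using *(8) xs by simp
  then show ?std using *(1-5) \<nu> standard_mset[OF *(2,4) \<nu>] by metis
next
  assume ?std
  then obtain t i \<nu> where *: "1 \<le> t" "t \<le> q - 1" "1 \<le> i" "i \<le> m - 1" "coprime i m"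
       "\<forall>k\<in>{1..m-1}. \<nu> k \<le> q - 1"
       "mset S = mset (replicate (q - 1) (gen_y [^]\<^bsub>G\<^esub> t)
                      @ map (\<lambda>k. gen_x [^]\<^bsub>G\<^esub> i \<otimes>\<^bsub>G\<^esub> gen_y [^]\<^bsub>G\<^esub> (\<nu> k :: nat)) [1..<m])"
    by blast
  have "free (mset S)"
    unfolding *(7) standard_mset[OF *(2,4,6)]
    by (rule free_standard[OF *(5) _ _ *(1,2)]) auto
  then show "product_one_free G S" using product_one_free_iff by simp
qed

end

theorem theorem2:
  fixes q m s :: nat and S :: "(nat \<times> nat) list"
  defines "G \<equiv> metacyclic m q s"
  assumes "prime q"
    and "m \<ge> 2" and "m dvd q - 1"
    and "0 < s" and "s < q" and "Pocklington.ord q s = m"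
    and "(m, q) \<noteq> (2, 3)"
    and "set S \<subseteq> carrier G"
    and "length S = m + q - 2"
  shows "product_one_free G S \<longleftrightarrow>
    (\<exists>t i \<nu>. 1 \<le> t \<and> t \<le> q - 1 \<and> 1 \<le> i \<and> i \<le> m - 1 \<and> coprime i m \<and>
       (\<forall>k\<in>{1..m-1}. \<nu> k \<le> q - 1) \<and>
       mset S = mset (replicate (q - 1) (gen_y [^]\<^bsub>G\<^esub> t)
                      @ map (\<lambda>k. gen_x [^]\<^bsub>G\<^esub> i \<otimes>\<^bsub>G\<^esub> gen_y [^]\<^bsub>G\<^esub> (\<nu> k :: nat)) [1..<m]))"
proof -
  interpret metacyclic_params q m s
    using assms by unfold_locales
  show ?thesis
    unfolding G_def using assms by (intro free_maximal_iff) (simp_all add: G_def)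
qed

end
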